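(* Let $S_2$ be a strongly $E^*$-unitary inverse semigroup with pure grading $\varphi:S_2^\times\to G$, and let $S_1\subseteq S_2$ be an inverse subsemigroup containing $0$ (an injective homomorphism preserving $0$ and all products), given the restricted pure grading. Suppose the induced inclusion of idempotent semilattices $E_1\subseteq E_2$ preserves finite covers. Then there is an induced injective morphism of partial actions $(\mathcal T_c(E_1),\Phi_1)\to(\mathcal T_c(E_2),\Phi_2)$, and consequently, for every commutative unital ring $R$, an injective $G$-graded $R$-algebra homomorphism $L_R(S_1,\varphi)\hookrightarrow L_R(S_2,\varphi)$ given by $x\delta_g\mapsto x\delta_g$ for $g\in G$ and $x\in E_{1,g}$.
   Context: An inverse semigroup with zero $S$ has unique inverses $s^*$; $E$ denotes its idempotents (a meet semilattice with $x\wedge y=xy$, least element $0$), $S^\times=S\setminus\{0\}$, $E^\times=E\setminus\{0\}$. A pure grading is a map $\varphi:S^\times\to G$ to a group with $\varphi(ab)=\varphi(a)\varphi(b)$ whenever $ab\ne0$ and $\varphi^{-1}(1_G)=E^\times$ (it restricts to a pure grading of any inverse subsemigroup containing $0$). For $S_i$ write $E_i$ for its idempotents, and $E_{i,g}=\{x\in E_i: x\le ss^*$ for some $s\in S_i$ with $\varphi(s)=g\}$ (or $\{0\}$ if no such $s$); $\phi_{i,g}:E_{i,g^{-1}}\to E_{i,g}$, $x\mapsto sxs^*$ ($s\in S_i$, $\varphi(s)=g$, $x\le s^*s$). For a meet semilattice $P$ with $0$: a filter is a subset $F$, $\emptyset\ne F\ne P$, closed upwards and under meets; $F(P)$ has topology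 generated by $\{F:x\in F\}$; tight filters $T(P)$ are the closure of the ultrafilters; $V^P_{(x:x_1,\dots,x_n)}=\{\xi\in T(P):x\in\xi, x_i\notin\xi\}$, $V_x=V_{(x:)}$; $\mathcal T_c(P)$ is the generalized Boolean algebra of compact open subsets of $T(P)$. A finite cover of $x\in P$ is a finite set of elements $\le x$ such that every $0\ne y\le x$ meets one of them nontrivially; $P_1\subseteq P_2$ preserves finite covers if every finite cover in $P_1$ of $x\in P_1$ is a finite cover of $x$ in $P_2$; then $U\mapsto\{\xi\in T(P_2):\xi\cap P_1\ne\emptyset,\ \xi\cap P_1\in U\}$ is an injective generalized Boolean algebra morphism $\mathcal T_c(P_1)\to\mathcal T_c(P_2)$ sending $V^{P_1}_{(x:x_1,\dots)}\mapsto V^{P_2}_{(x:x_1,\dots)}$. $\mathcal T_c(E_{i,g})$ is identified in this way with an ideal of $\mathcal T_c(E_i)$, and $\hat\phi_{i,g}:\mathcal T_c(E_{i,g^{-1}})\to\mathcal T_c(E_{i,g})$ is the isomorphism induced by $\phi_{i,g}$; $\Phi_i=(\{\mathcal T_c(E_{i,g})\},\{\hat\phi_{i,g}\})$ is a partial action of $G$ on $\mathcal T_c(E_i)$. A morphism of partial actions $(\mathcal B_1,\{\mathcal I_{1,t}\},\{\psi_{1,t}\})\to(\mathcal B_2,\{\mathcal I_{2,t}\},\{\psi_{2,t}\})$ is a generalized Boolean algebra morphism $f$ with $f(\mathcal I_{1,t})\subseteq\mathcal I_{2,t}$ and $f\psi_{1,t}=\psi_{2,t}f$ on $\mathcal I_{1,t^{-1}}$.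 For a partial action $\Phi=(\{\mathcal I_t\},\{\psi_t\})$ on $\mathcal B$ and commutative unital ring $R$: $\mathrm{Lc}(R,\mathcal B)$ is the $R$-algebra of functions $f:R\setminus\{0\}\to\mathcal B$ with pairwise disjoint values, almost all $0$, viewed as $\sum_r r1_{f(r)}$; $\mathrm{Lc}(R,\mathcal B)\rtimes_\Phi G$ consists of finite sums $\sum_t f_t\delta_t$, $f_t\in\mathrm{Lc}(R,\mathcal I_t)$, with $(a\delta_s)(b\delta_t)=\tilde\psi_s(\tilde\psi_{s^{-1}}(a)b)\delta_{st}$, $\tilde\psi_t(f)=\psi_t\circ f$, graded by $a\delta_g\mapsto g$. $L_R(S_i,\varphi):=\mathrm{Lc}(R,\mathcal T_c(E_i))\rtimes_{\Phi_i}G$, and $x\delta_g:=1_{V_x}\delta_g$ for $x\in E_{i,g}$.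
   Formalization: The topology on F(P) is generated by the sets {F : x∈F} together with {F : x∉F}; with only the former, compact open sets need not form a generalized Boolean algebra (e.g. P={0<e<1}). The ring R is taken to be nonzero. *)

theory Defs
  imports "HOL-Analysis.Analysis" "HOL-Algebra.Group"
begin

definition inverse_semigroup_zero :: "'a set \<Rightarrow> ('a \<Rightarrow> 'a \<Rightarrow> 'a) \<Rightarrow> 'a \<Rightarrow> bool" where
  "inverse_semigroup_zero S m z \<longleftrightarrow>
     z \<in> S \<and>
     (\<forall>x\<in>S. \<forall>y\<in>S. m x y \<in> S) \<and>
     (\<forall>x\<in>S. \<forall>y\<in>S. \<forall>w\<in>S. m (m x y) w = m x (m y w)) \<and>
     (\<forall>x\<in>S. m z x = z \<and> m x z = z) \<and>
     (\<forall>s\<in>S. \<exists>!t. t \<in> S \<and> m (m s t) s = s \<and> m (m t s) t = t)"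

definition sinv :: "'a set \<Rightarrow> ('a \<Rightarrow> 'a \<Rightarrow> 'a) \<Rightarrow> 'a \<Rightarrow> 'a" where
  "sinv S m s = (THE t. t \<in> S \<and> m (m s t) s = s \<and> m (m t s) t = t)"

definition idems :: "'a set \<Rightarrow> ('a \<Rightarrow> 'a \<Rightarrow> 'a) \<Rightarrow> 'a set" where
  "idems S m = {e \<in> S. m e e = e}"

definition sleq :: "('a \<Rightarrow> 'a \<Rightarrow> 'a) \<Rightarrow> 'a \<Rightarrow> 'a \<Rightarrow> bool" where
  "sleq m x y \<longleftrightarrow> m x y = x"

definition inverse_subsemigroup :: "'a set \<Rightarrow> 'a set \<Rightarrow> ('a \<Rightarrow> 'a \<Rightarrow> 'a) \<Rightarrow> 'a \<Rightarrow> bool" where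
  "inverse_subsemigroup S1 S m z \<longleftrightarrow>
     S1 \<subseteq> S \<and> z \<in> S1 \<and> (\<forall>x\<in>S1. \<forall>y\<in>S1. m x y \<in> S1) \<and> (\<forall>s\<in>S1. sinv S m s \<in> S1)"

definition pure_grading ::
  "'a set \<Rightarrow> ('a \<Rightarrow> 'a \<Rightarrow> 'a) \<Rightarrow> 'a \<Rightarrow> ('g, 'b) monoid_scheme \<Rightarrow> ('a \<Rightarrow> 'g) \<Rightarrow> bool" where
  "pure_grading S m z G \<phi> \<longleftrightarrow>
     (\<forall>s\<in>S - {z}. \<phi> s \<in> carrier G) \<and>
     (\<forall>a\<in>S - {z}. \<forall>b\<in>S - {z}. m a b \<noteq> z \<longrightarrow> \<phi> (m a b) = \<phi> a \<otimes>\<^bsub>G\<^esub> \<phi> b) \<and>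
     {s \<in> S - {z}. \<phi> s = \<one>\<^bsub>G\<^esub>} = idems S m - {z}"

text \<open>Strongly E*-unitary: admits a pure grading (to some group; here witnessed on the type of G).\<close>

definition is_filter :: "'a set \<Rightarrow> ('a \<Rightarrow> 'a \<Rightarrow> 'a) \<Rightarrow> 'a set \<Rightarrow> bool" where
  "is_filter P m F \<longleftrightarrow>
     F \<noteq> {} \<and> F \<subseteq> P \<and> F \<noteq> P \<and>
     (\<forall>x\<in>F. \<forall>y\<in>P. sleq m x y \<longrightarrow> y \<in> F) \<and>
     (\<forall>x\<in>F. \<forall>y\<in>F. m x y \<in> F)"

definition filters :: "'a set \<Rightarrow> ('a \<Rightarrow> 'a \<Rightarrow> 'a) \<Rightarrow> 'a set set" where
  "filters P m = {F. is_filter P m F}"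

definition ultrafilters :: "'a set \<Rightarrow> ('a \<Rightarrow> 'a \<Rightarrow> 'a) \<Rightarrow> 'a set set" where
  "ultrafilters P m = {F \<in> filters P m. \<forall>F' \<in> filters P m. F \<subseteq> F' \<longrightarrow> F' = F}"

definition filter_topology :: "'a set \<Rightarrow> ('a \<Rightarrow> 'a \<Rightarrow> 'a) \<Rightarrow> 'a set topology" where
  "filter_topology P m = topology_generated_by
     ({filters P m} \<union> {{F \<in> filters P m. x \<in> F} | x. x \<in> P}
                    \<union> {{F \<in> filters P m. x \<notin> F} | x. x \<in> P})"

definition tight :: "'a set \<Rightarrow> ('a \<Rightarrow> 'a \<Rightarrow> 'a) \<Rightarrow> 'a set set" where
  "tight P m = (filter_topology P m) closure_of (ultrafilters P m)"

definition Tc :: "'a set \<Rightarrow> ('a \<Rightarrow> 'a \<Rightarrow> 'a) \<Rightarrow> 'a set set set" where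
  "Tc P m = {U. openin (subtopology (filter_topology P m) (tight P m)) U \<and>
               compactin (subtopology (filter_topology P m) (tight P m)) U}"

definition Vset :: "'a set \<Rightarrow> ('a \<Rightarrow> 'a \<Rightarrow> 'a) \<Rightarrow> 'a \<Rightarrow> 'a list \<Rightarrow> 'a set set" where
  "Vset P m x xs = {\<xi> \<in> tight P m. x \<in> \<xi> \<and> (\<forall>y \<in> set xs. y \<notin> \<xi>)}"

definition finite_cover :: "'a set \<Rightarrow> ('a \<Rightarrow> 'a \<Rightarrow> 'a) \<Rightarrow> 'a \<Rightarrow> 'a \<Rightarrow> 'a set \<Rightarrow> bool" where
  "finite_cover P m z x C \<longleftrightarrow> finite C \<and> C \<subseteq> P \<and> (\<forall>c\<in>C. sleq m c x) \<and>
     (\<forall>y\<in>P. y \<noteq> z \<and> sleq m y x \<longrightarrow> (\<exists>c\<in>C. m y c \<noteq> z))"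

definition preserves_finite_covers :: "'a set \<Rightarrow> 'a set \<Rightarrow> ('a \<Rightarrow> 'a \<Rightarrow> 'a) \<Rightarrow> 'a \<Rightarrow> bool" where
  "preserves_finite_covers P1 P2 m z \<longleftrightarrow>
     (\<forall>x\<in>P1. \<forall>C. finite_cover P1 m z x C \<longrightarrow> finite_cover P2 m z x C)"

definition emb :: "'a set \<Rightarrow> 'a set \<Rightarrow> ('a \<Rightarrow> 'a \<Rightarrow> 'a) \<Rightarrow> 'a set set \<Rightarrow> 'a set set" where
  "emb P1 P2 m U = {\<xi> \<in> tight P2 m. \<xi> \<inter> P1 \<noteq> {} \<and> \<xi> \<inter> P1 \<in> U}"

definition Egr :: "'a set \<Rightarrow> ('a \<Rightarrow> 'a \<Rightarrow> 'a) \<Rightarrow> 'a \<Rightarrow> ('a \<Rightarrow> 'g) \<Rightarrow> 'g \<Rightarrow> 'a set" where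
  "Egr S m z \<phi> g = insert z {x \<in> idems S m. \<exists>s \<in> S - {z}. \<phi> s = g \<and> sleq m x (m s (sinv S m s))}"

definition phimap :: "'a set \<Rightarrow> ('a \<Rightarrow> 'a \<Rightarrow> 'a) \<Rightarrow> 'a \<Rightarrow> ('a \<Rightarrow> 'g) \<Rightarrow> 'g \<Rightarrow> 'a \<Rightarrow> 'a" where
  "phimap S m z \<phi> g x = (if x = z then z else
     (SOME y. \<exists>s \<in> S - {z}. \<phi> s = g \<and> sleq m x (m (sinv S m s) s) \<and> y = m (m s x) (sinv S m s)))"

text \<open>The ideal T_c(E_g), identified with an ideal of T_c(E).\<close>
definition Iact :: "'a set \<Rightarrow> ('a \<Rightarrow> 'a \<Rightarrow> 'a) \<Rightarrow> 'a \<Rightarrow> ('a \<Rightarrow> 'g) \<Rightarrow> 'g \<Rightarrow> 'a set set set" where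
  "Iact S m z \<phi> g = emb (Egr S m z \<phi> g) (idems S m) m ` Tc (Egr S m z \<phi> g) m"

text \<open>The isomorphism induced by \<phi>_g, transported along the identifications.\<close>
definition psiact :: "'a set \<Rightarrow> ('a \<Rightarrow> 'a \<Rightarrow> 'a) \<Rightarrow> 'a \<Rightarrow> ('g, 'b) monoid_scheme \<Rightarrow> ('a \<Rightarrow> 'g)
                      \<Rightarrow> 'g \<Rightarrow> 'a set set \<Rightarrow> 'a set set" where
  "psiact S m z G \<phi> g V =
     (let Ei = Egr S m z \<phi> (inv\<^bsub>G\<^esub> g); Eg = Egr S m z \<phi> g;
          U = (THE U. U \<in> Tc Ei m \<and> emb Ei (idems S m) m U = V)
      in emb Eg (idems S m) m ((\<lambda>\<xi>. phimap S m z \<phi> g ` \<xi>) ` U))"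

definition gba_hom :: "'p set set \<Rightarrow> 'q set set \<Rightarrow> ('p set \<Rightarrow> 'q set) \<Rightarrow> bool" where
  "gba_hom B1 B2 f \<longleftrightarrow> (\<forall>U\<in>B1. f U \<in> B2) \<and>
     (\<forall>U\<in>B1. \<forall>V\<in>B1. f (U \<union> V) = f U \<union> f V \<and> f (U \<inter> V) = f U \<inter> f V \<and> f (U - V) = f U - f V)"

definition pa_morphism ::
  "('g, 'b) monoid_scheme \<Rightarrow> 'p set set \<Rightarrow> ('g \<Rightarrow> 'p set set) \<Rightarrow> ('g \<Rightarrow> 'p set \<Rightarrow> 'p set)
     \<Rightarrow> 'q set set \<Rightarrow> ('g \<Rightarrow> 'q set set) \<Rightarrow> ('g \<Rightarrow> 'q set \<Rightarrow> 'q set) \<Rightarrow> ('p set \<Rightarrow> 'q set) \<Rightarrow> bool" where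
  "pa_morphism G B1 I1 \<psi>1 B2 I2 \<psi>2 f \<longleftrightarrow> gba_hom B1 B2 f \<and>
     (\<forall>t\<in>carrier G. f ` I1 t \<subseteq> I2 t \<and>
        (\<forall>U \<in> I1 (inv\<^bsub>G\<^esub> t). f (\<psi>1 t U) = \<psi>2 t (f U)))"

section \<open>The algebra L_R(S,\<phi>) = Lc(R, T_c(E)) \<rtimes> G\<close>

text \<open>Lc(R,B): an element f : R\<setminus>{0} \<rightarrow> B is represented by the function \<Sum>_r r 1_{f(r)}
  on the space X; f(r) is recovered as the level set at r.\<close>
definition Lc :: "'p set \<Rightarrow> 'p set set \<Rightarrow> ('p \<Rightarrow> 'r::comm_ring_1) set" where
  "Lc X B = {h. (\<forall>\<xi>. \<xi> \<notin> X \<longrightarrow> h \<xi> = 0) \<and> finite (range h) \<and> (\<forall>r. r \<noteq> 0 \<longrightarrow> {\<xi>. h \<xi> = r} \<in> B)}"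

text \<open>\<tilde>\<psi>_t(f) = \<psi>_t \<circ> f, in the function representation.\<close>
definition lift :: "('p set \<Rightarrow> 'p set) \<Rightarrow> ('p \<Rightarrow> 'r::comm_ring_1) \<Rightarrow> 'p \<Rightarrow> 'r" where
  "lift \<psi>t h = (\<lambda>\<xi>. \<Sum>r \<in> range h - {0}. if \<xi> \<in> \<psi>t {\<eta>. h \<eta> = r} then r else 0)"

text \<open>Elements \<Sum>_t f_t \<delta>_t are represented as t \<mapsto> f_t (finite support).\<close>
definition cp_carrier :: "('g, 'b) monoid_scheme \<Rightarrow> 'p set \<Rightarrow> ('g \<Rightarrow> 'p set set)
                          \<Rightarrow> ('g \<Rightarrow> 'p \<Rightarrow> 'r::comm_ring_1) set" where
  "cp_carrier G X I = {a. finite {t. a t \<noteq> (\<lambda>_. 0)} \<and> (\<forall>t. t \<notin> carrier G \<longrightarrow> a t = (\<lambda>_. 0)) \<and>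
                          (\<forall>t\<in>carrier G. a t \<in> Lc X (I t))}"

definition cp_add :: "('g \<Rightarrow> 'p \<Rightarrow> 'r::comm_ring_1) \<Rightarrow> ('g \<Rightarrow> 'p \<Rightarrow> 'r) \<Rightarrow> 'g \<Rightarrow> 'p \<Rightarrow> 'r" where
  "cp_add a b = (\<lambda>t \<xi>. a t \<xi> + b t \<xi>)"

definition cp_smult :: "'r::comm_ring_1 \<Rightarrow> ('g \<Rightarrow> 'p \<Rightarrow> 'r) \<Rightarrow> 'g \<Rightarrow> 'p \<Rightarrow> 'r" where
  "cp_smult c a = (\<lambda>t \<xi>. c * a t \<xi>)"

text \<open>(a \<delta>_s)(b \<delta>_t) = \<tilde>\<psi>_s(\<tilde>\<psi>_{s^{-1}}(a) b) \<delta>_{st}, extended bilinearly.\<close>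
definition cp_mult :: "('g, 'b) monoid_scheme \<Rightarrow> ('g \<Rightarrow> 'p set \<Rightarrow> 'p set)
                       \<Rightarrow> ('g \<Rightarrow> 'p \<Rightarrow> 'r::comm_ring_1) \<Rightarrow> ('g \<Rightarrow> 'p \<Rightarrow> 'r) \<Rightarrow> 'g \<Rightarrow> 'p \<Rightarrow> 'r" where
  "cp_mult G \<psi> a b = (\<lambda>u \<xi>. \<Sum>(s, t) \<in> {(s, t). a s \<noteq> (\<lambda>_. 0) \<and> b t \<noteq> (\<lambda>_. 0) \<and> s \<otimes>\<^bsub>G\<^esub> t = u}.
       lift (\<psi> s) (\<lambda>\<eta>. lift (\<psi> (inv\<^bsub>G\<^esub> s)) (a s) \<eta> * b t \<eta>) \<xi>)"

abbreviation LR_carrier :: "'a set \<Rightarrow> ('a \<Rightarrow> 'a \<Rightarrow> 'a) \<Rightarrow> 'a \<Rightarrow> ('g, 'b) monoid_scheme \<Rightarrow> ('a \<Rightarrow> 'g)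
                            \<Rightarrow> ('g \<Rightarrow> 'a set \<Rightarrow> 'r::comm_ring_1) set" where
  "LR_carrier S m z G \<phi> \<equiv> cp_carrier G (tight (idems S m) m) (Iact S m z \<phi>)"

abbreviation LR_mult :: "'a set \<Rightarrow> ('a \<Rightarrow> 'a \<Rightarrow> 'a) \<Rightarrow> 'a \<Rightarrow> ('g, 'b) monoid_scheme \<Rightarrow> ('a \<Rightarrow> 'g)
     \<Rightarrow> ('g \<Rightarrow> 'a set \<Rightarrow> 'r::comm_ring_1) \<Rightarrow> ('g \<Rightarrow> 'a set \<Rightarrow> 'r) \<Rightarrow> 'g \<Rightarrow> 'a set \<Rightarrow> 'r" where
  "LR_mult S m z G \<phi> \<equiv> cp_mult G (psiact S m z G \<phi>)"

definition xdelta :: "'a set \<Rightarrow> ('a \<Rightarrow> 'a \<Rightarrow> 'a) \<Rightarrow> 'a \<Rightarrow> 'g \<Rightarrow> 'g \<Rightarrow> 'a set \<Rightarrow> 'r::comm_ring_1" where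
  "xdelta E m x g = (\<lambda>t \<xi>. if t = g \<and> \<xi> \<in> Vset E m x [] then 1 else 0)"

end

theory Submission
  imports Defs
begin

text \<open>
  A filter is tight iff it meets every finite cover of each of its elements. Hence, if \<open>P \<subseteq> Q\<close>
  preserves finite covers, a tight filter of \<open>Q\<close> meeting \<open>P\<close> restricts to a tight filter of \<open>P\<close>, and
  \<open>emb\<close>, the preimage under this restriction, sends \<open>V\<^sup>P(x : ys)\<close> to \<open>V\<^sup>Q(x : ys)\<close>. Every compact open
  set is a finite union of such sets, because the filters containing a given \<open>x\<close> form a compact
  space; and \<open>V(x : ys)\<close> is nonempty iff some nonzero element below \<open>x\<close> is disjoint from all of \<open>ys\<close>,
  a condition that persists from \<open>P\<close> to \<open>Q\<close>. So \<open>emb\<close> is an embedding of compact opens.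

  Purity makes \<open>s x s\<^sup>*\<close> depend only on \<open>x\<close> and the degree of \<open>s\<close>, so the semilattice isomorphisms
  of \<open>S\<^sub>2\<close> extend those of \<open>S\<^sub>1\<close>, and \<open>emb\<close> is equivariant. The algebra map composes each coefficient
  function with the restriction of tight filters; its level sets are the images under \<open>emb\<close> of the
  original ones, which reduces multiplicativity and injectivity to the statements about \<open>emb\<close>.
\<close>

section \<open>Tight filters and compact open sets\<close>

locale semilattice_zero =
  fixes P :: "'a set" and m :: "'a \<Rightarrow> 'a \<Rightarrow> 'a" and z :: 'a
  assumes zero_closed [simp]: "z \<in> P"
    and meet_closed [simp]: "\<lbrakk>x \<in> P; y \<in> P\<rbrakk> \<Longrightarrow> m x y \<in> P"
    and meet_assoc: "\<lbrakk>x \<in> P; y \<in> P; w \<in> P\<rbrakk> \<Longrightarrow> m (m x y) w = m x (m y w)"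
    and meet_comm: "\<lbrakk>x \<in> P; y \<in> P\<rbrakk> \<Longrightarrow> m x y = m y x"
    and meet_idem [simp]: "x \<in> P \<Longrightarrow> m x x = x"
    and meet_zero_left [simp]: "x \<in> P \<Longrightarrow> m z x = z"
begin

section \<open>Order and meets in a semilattice with zero\<close>

lemma meet_zero_right [simp]: "x \<in> P \<Longrightarrow> m x z = z"
  using meet_comm[of x z] by simp

lemma meet_left_comm: "\<lbrakk>x \<in> P; y \<in> P; w \<in> P\<rbrakk> \<Longrightarrow> m x (m y w) = m y (m x w)"
  by (metis meet_assoc meet_comm)

lemma meet_left_idem [simp]: "\<lbrakk>x \<in> P; y \<in> P\<rbrakk> \<Longrightarrow> m x (m x y) = m x y"
  by (metis meet_assoc meet_idem)

lemma sleq_meet_left: "\<lbrakk>x \<in> P; y \<in> P\<rbrakk> \<Longrightarrow> sleq m (m x y) x"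
  by (simp add: sleq_def meet_assoc meet_comm[of y x])

lemma sleq_meet_right: "\<lbrakk>x \<in> P; y \<in> P\<rbrakk> \<Longrightarrow> sleq m (m x y) y"
  by (simp add: sleq_def meet_assoc)

lemma sleq_trans: "\<lbrakk>x \<in> P; y \<in> P; w \<in> P; sleq m x y; sleq m y w\<rbrakk> \<Longrightarrow> sleq m x w"
  by (metis sleq_def meet_assoc)

lemma sleq_antisym: "\<lbrakk>x \<in> P; y \<in> P; sleq m x y; sleq m y x\<rbrakk> \<Longrightarrow> x = y"
  by (metis sleq_def meet_comm)

lemma sleq_meetI: "\<lbrakk>x \<in> P; y \<in> P; w \<in> P; sleq m w x; sleq m w y\<rbrakk> \<Longrightarrow> sleq m w (m x y)"
  by (metis sleq_def meet_assoc)

text \<open>Since \<open>z\<close> lies below everything, an upward closed set is proper exactly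
  when it misses \<open>z\<close>.\<close>

lemma filters_iff:
  "F \<in> filters P m \<longleftrightarrow>
     F \<noteq> {} \<and> F \<subseteq> P \<and> z \<notin> F \<and> (\<forall>x\<in>F. \<forall>y\<in>P. sleq m x y \<longrightarrow> y \<in> F) \<and> (\<forall>x\<in>F. \<forall>y\<in>F. m x y \<in> F)"
proof -
  have "F = P" if "z \<in> F" "F \<subseteq> P" "\<forall>x\<in>F. \<forall>y\<in>P. sleq m x y \<longrightarrow> y \<in> F"
    using that by (auto simp: sleq_def)
  then show ?thesis
    unfolding filters_def is_filter_def by (auto simp: zero_closed)
qed

lemma filter_meet_iff:
  assumes "F \<in> filters P m" "x \<in> P" "y \<in> P"
  shows "m x y \<in> F \<longleftrightarrow> x \<in> F \<and> y \<in> F"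
  using assms sleq_meet_left[of x y] sleq_meet_right[of x y] meet_closed[of x y]
  by (auto simp: filters_iff)

section \<open>Ultrafilters: existence and disjointness\<close>

lemma ultrafilter_containing:
  assumes "w \<in> P" "w \<noteq> z"
  obtains F where "F \<in> ultrafilters P m" "w \<in> F"
proof -
  let ?A = "{F \<in> filters P m. w \<in> F}"
  \<comment> \<open>The principal filter of \<open>w\<close> gives Zorn's lemma a nonempty family;
    it is proper because \<open>w\<close> is not \<open>z\<close>.\<close>
  have "{p \<in> P. sleq m w p} \<in> ?A"
  proof (rule CollectI, unfold filters_iff, intro conjI ballI impI)
    show "{p \<in> P. sleq m w p} \<noteq> {}"
      using assms by (auto simp: sleq_def intro!: exI[of _ w])
    show "z \<notin> {p \<in> P. sleq m w p}" "w \<in> {p \<in> P. sleq m w p}"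
      using assms by (auto simp: sleq_def)
  qed (use assms in \<open>auto intro: sleq_trans sleq_meetI\<close>)
  then have ne: "?A \<noteq> {}"
    by blast
  have "\<exists>M\<in>?A. \<forall>X\<in>?A. M \<subseteq> X \<longrightarrow> X = M"
  proof (rule subset_Zorn_nonempty[OF ne])
    fix C assume C: "C \<noteq> {}" "subset.chain ?A C"
    then have sub: "C \<subseteq> ?A" and tot: "\<And>X Y. X \<in> C \<Longrightarrow> Y \<in> C \<Longrightarrow> X \<subseteq> Y \<or> Y \<subseteq> X"
      by (auto simp: subset_chain_def)
    have "m x y \<in> \<Union>C" if xy: "x \<in> X" "X \<in> C" "y \<in> Y" "Y \<in> C" for x y X Y
    proof -
      obtain W where "W \<in> C" "x \<in> W" "y \<in> W"
        using tot[of X Y] xy by blast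
      then show ?thesis
        using sub by (auto simp: filters_iff)
    qed
    moreover have "\<Union>C \<noteq> {}" "w \<in> \<Union>C"
      using C sub by blast+
    moreover have "\<Union>C \<subseteq> P" "z \<notin> \<Union>C"
      using sub by (auto simp: filters_iff)
    moreover have "\<forall>x\<in>\<Union>C. \<forall>y\<in>P. sleq m x y \<longrightarrow> y \<in> \<Union>C"
    proof (intro ballI impI)
      fix x y assume "x \<in> \<Union>C" "y \<in> P" "sleq m x y"
      then obtain X where "X \<in> C" "x \<in> X" by blast
      then have "X \<in> filters P m" using sub by blast
      then have "y \<in> X"
        using \<open>x \<in> X\<close> \<open>y \<in> P\<close> \<open>sleq m x y\<close> by (auto simp: filters_iff)
      then show "y \<in> \<Union>C" using \<open>X \<in> C\<close> by blast
    qed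
    ultimately show "\<Union>C \<in> ?A"
      by (auto simp: filters_iff)
  qed
  then obtain M where M: "M \<in> ?A" "\<And>X. X \<in> ?A \<Longrightarrow> M \<subseteq> X \<Longrightarrow> X = M"
    by blast
  \<comment> \<open>Every filter larger than \<open>M\<close> still contains \<open>w\<close>, so
    maximality inside \<open>?A\<close> is maximality among all filters.\<close>
  then have "M \<in> ultrafilters P m"
    unfolding ultrafilters_def by blast
  then show ?thesis
    using M that by blast
qed

text \<open>Otherwise the elements of \<open>F\<close> together with \<open>c\<close> would generate
  a proper filter \<open>?F'\<close> strictly larger than \<open>F\<close>.\<close>

lemma ultrafilter_disjoint:
  assumes F: "F \<in> ultrafilters P m" and c: "c \<in> P" "c \<notin> F"
  shows "\<exists>y\<in>F. m y c = z"
proof (rule ccontr)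
  assume neg: "\<not> (\<exists>y\<in>F. m y c = z)"
  have Ff: "F \<in> filters P m" and max: "\<And>F'. F' \<in> filters P m \<Longrightarrow> F \<subseteq> F' \<Longrightarrow> F' = F"
    using F unfolding ultrafilters_def by auto
  have FP: "F \<subseteq> P"
    using Ff by (simp add: filters_iff)
  let ?F' = "{p \<in> P. \<exists>y\<in>F. sleq m (m y c) p}"
  have sub: "F \<subseteq> ?F'"
    using FP c by (auto intro!: bexI sleq_meet_left)
  obtain y0 where y0: "y0 \<in> F"
    using Ff by (auto simp: filters_iff)
  have "c \<in> ?F'"
    using y0 FP c by (auto intro!: bexI[of _ y0] sleq_meet_right)
  moreover have "?F' \<in> filters P m"
    unfolding filters_iff
  proof (intro conjI ballI impI)
    show "?F' \<noteq> {}" "?F' \<subseteq> P"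
      using \<open>c \<in> ?F'\<close> by auto
    show "z \<notin> ?F'"
      using neg FP c by (auto simp: sleq_def subset_iff)
  next
    fix x p assume "x \<in> ?F'" "p \<in> P" "sleq m x p"
    then obtain y where y: "y \<in> F" "sleq m (m y c) x" "x \<in> P"
      by blast
    then have "sleq m (m y c) p"
      using sleq_trans[of "m y c" x p] \<open>p \<in> P\<close> \<open>sleq m x p\<close> FP c by (auto simp: subset_iff)
    then show "p \<in> ?F'"
      using y \<open>p \<in> P\<close> by blast
  next
    fix p q assume "p \<in> ?F'" "q \<in> ?F'"
    then obtain x y where xy: "x \<in> F" "y \<in> F" "sleq m (m x c) p" "sleq m (m y c) q"
      and pq: "p \<in> P" "q \<in> P"
      by blast
    have P: "x \<in> P" "y \<in> P"
      using xy FP by auto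
    have "sleq m (m (m x y) c) (m x c)" "sleq m (m (m x y) c) (m y c)"
      using P c by (simp_all add: sleq_def meet_assoc meet_comm meet_left_comm)
    then have "sleq m (m (m x y) c) p" "sleq m (m (m x y) c) q"
      using sleq_trans[of "m (m x y) c" "m x c" p] sleq_trans[of "m (m x y) c" "m y c" q]
        P c pq xy by auto
    then have "sleq m (m (m x y) c) (m p q)"
      using P c pq by (intro sleq_meetI) auto
    moreover have "m x y \<in> F"
      using xy Ff by (auto simp: filters_iff)
    ultimately show "m p q \<in> ?F'"
      using pq by auto
  qed
  ultimately show False
    using max[OF _ sub] c by blast
qed

text \<open>The witnesses that \<open>ultrafilter_disjoint\<close> gives for the single elements of
  \<open>C\<close> are met with one another and with \<open>x\<close>; the result stays in
  \<open>F\<close>.\<close>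

lemma ultrafilter_disjoint_finite:
  assumes F: "F \<in> ultrafilters P m" and x: "x \<in> F" and C: "finite C" "C \<subseteq> P" "C \<inter> F = {}"
  shows "\<exists>y\<in>F. sleq m y x \<and> (\<forall>c\<in>C. m y c = z)"
  using C
proof (induction C rule: finite_induct)
  case empty
  have "x \<in> P"
    using F x by (auto simp: ultrafilters_def filters_iff)
  then show ?case
    using x by (intro bexI[of _ x]) (simp_all add: sleq_def)
next
  case (insert c C)
  have Ff: "F \<in> filters P m" and FP: "F \<subseteq> P"
    using F by (auto simp: ultrafilters_def filters_iff)
  obtain y where y: "y \<in> F" "sleq m y x" "\<forall>c\<in>C. m y c = z"
    using insert by auto
  obtain w where w: "w \<in> F" "m w c = z"
    using ultrafilter_disjoint[OF F, of c] insert by auto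
  have P: "y \<in> P" "w \<in> P" "x \<in> P" "c \<in> P"
    using FP y w x insert by auto
  have "m y w \<in> F"
    using Ff y w by (auto simp: filters_iff)
  moreover have "sleq m (m y w) x"
    using P y sleq_trans[of "m y w" y x] by (simp add: sleq_meet_left)
  moreover have "m (m y w) c' = z" if "c' \<in> insert c C" for c'
  proof (cases "c' = c")
    case True
    then show ?thesis using P w by (simp add: meet_assoc)
  next
    case False
    then have "c' \<in> C" "c' \<in> P"
      using that insert by auto
    then show ?thesis
      using P y by (metis meet_assoc meet_comm meet_zero_right)
  qed
  ultimately show ?case
    by blast
qed

section \<open>Basic open sets of the filter space\<close>

lemma openin_filter_basic:
  assumes "x \<in> P" "set ys \<subseteq> P"
  shows "openin (filter_topology P m) {F \<in> filters P m. x \<in> F \<and> (\<forall>y\<in>set ys. y \<notin> F)}"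
  using assms(2)
proof (induction ys)
  case Nil
  have "openin (filter_topology P m) {F \<in> filters P m. x \<in> F}"
    unfolding filter_topology_def by (rule topology_generated_by_Basis) (use assms(1) in auto)
  then show ?case by simp
next
  case (Cons y ys)
  have "openin (filter_topology P m) {F \<in> filters P m. y \<notin> F}"
    unfolding filter_topology_def by (rule topology_generated_by_Basis) (use Cons in auto)
  moreover have "openin (filter_topology P m) {F \<in> filters P m. x \<in> F \<and> (\<forall>y\<in>set ys. y \<notin> F)}"
    using Cons by simp
  ultimately have "openin (filter_topology P m)
      ({F \<in> filters P m. y \<notin> F} \<inter> {F \<in> filters P m. x \<in> F \<and> (\<forall>y\<in>set ys. y \<notin> F)})"
    by (rule openin_Int)
  moreover have "{F \<in> filters P m. y \<notin> F} \<inter> {F \<in> filters P m. x \<in> F \<and> (\<forall>y\<in>set ys. y \<notin> F)}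
      = {F \<in> filters P m. x \<in> F \<and> (\<forall>y\<in>set (y # ys). y \<notin> F)}"
    by auto
  ultimately show ?case by simp
qed

lemma topspace_filter_topology [simp]: "topspace (filter_topology P m) = filters P m"
  unfolding filter_topology_def by auto

text \<open>Finitely many positive conditions merge into one, because a filter contains a meet iff
  it contains both factors. So one positive and finitely many negative conditions suffice for a
  neighbourhood base.\<close>

lemma filter_topology_basis:
  assumes "openin (filter_topology P m) U" "\<xi> \<in> U"
  shows "\<exists>x ys. x \<in> \<xi> \<and> set ys \<subseteq> P - \<xi> \<and>
           {F \<in> filters P m. x \<in> F \<and> (\<forall>y\<in>set ys. y \<notin> F)} \<subseteq> U"
proof -
  have "generate_topology_on ({filters P m} \<union> {{F \<in> filters P m. x \<in> F} | x. x \<in> P}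
                    \<union> {{F \<in> filters P m. x \<notin> F} | x. x \<in> P}) U"
    using assms(1) unfolding filter_topology_def openin_topology_generated_by_iff .
  then show ?thesis
    using assms(2)
  proof (induction arbitrary: \<xi>)
    case Empty
    then show ?case by simp
  next
    case (Int a b)
    obtain x ys where 1: "x \<in> \<xi>" "set ys \<subseteq> P - \<xi>"
      "{F \<in> filters P m. x \<in> F \<and> (\<forall>y\<in>set ys. y \<notin> F)} \<subseteq> a"
      using Int.IH(1)[of \<xi>] Int.prems by auto
    obtain x' ys' where 2: "x' \<in> \<xi>" "set ys' \<subseteq> P - \<xi>"
      "{F \<in> filters P m. x' \<in> F \<and> (\<forall>y\<in>set ys'. y \<notin> F)} \<subseteq> b"
      using Int.IH(2)[of \<xi>] Int.prems by auto
    have "openin (filter_topology P m) a"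
      unfolding filter_topology_def openin_topology_generated_by_iff by (rule Int)
    then have \<xi>: "\<xi> \<in> filters P m"
      using Int.prems openin_subset by fastforce
    then have "\<xi> \<subseteq> P"
      by (simp add: filters_iff)
    then have P: "x \<in> P" "x' \<in> P"
      using 1 2 by auto
    show ?case
    proof (intro exI[of _ "m x x'"] exI[of _ "ys @ ys'"] conjI)
      show "m x x' \<in> \<xi>"
        using \<xi> 1 2 P by (simp add: filter_meet_iff)
      show "set (ys @ ys') \<subseteq> P - \<xi>"
        using 1 2 by auto
      show "{F \<in> filters P m. m x x' \<in> F \<and> (\<forall>y\<in>set (ys @ ys'). y \<notin> F)} \<subseteq> a \<inter> b"
        using 1 2 P by (auto simp: filter_meet_iff)
    qed
  next
    case (UN K)
    then obtain k where "k \<in> K" "\<xi> \<in> k" by blast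
    with UN.IH[OF this] show ?case by blast
  next
    case (Basis s)
    then have \<xi>: "\<xi> \<in> filters P m"
      by blast
    \<comment> \<open>A basic set carries exactly one positive condition; when the subbasic set
      imposes none, any element \<open>w\<close> of the nonempty filter supplies it.\<close>
    then obtain w where w: "w \<in> \<xi>"
      by (auto simp: filters_iff)
    from Basis consider "s = filters P m" | x where "x \<in> P" "s = {F \<in> filters P m. x \<in> F}"
      | x where "x \<in> P" "s = {F \<in> filters P m. x \<notin> F}"
      by blast
    then show ?case
    proof cases
      case 1
      then show ?thesis using w by (intro exI[of _ w] exI[of _ "[]"]) auto
    next
      case 2
      then show ?thesis using Basis by (intro exI[of _ x] exI[of _ "[]"]) auto
    next
      case 3
      then show ?thesis using Basis w by (intro exI[of _ w] exI[of _ "[x]"]) auto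
    qed
  qed
qed

section \<open>Finite covers and the description of tight filters\<close>

lemma finite_coverI_meets:
  assumes "x \<in> P" "set ys \<subseteq> P"
    "\<And>w. w \<in> P \<Longrightarrow> w \<noteq> z \<Longrightarrow> sleq m w x \<Longrightarrow> \<exists>y\<in>set ys. m w y \<noteq> z"
  shows "finite_cover P m z x (m x ` set ys)"
  unfolding finite_cover_def
proof (intro conjI ballI impI)
  show "finite (m x ` set ys)" "m x ` set ys \<subseteq> P"
    using assms by auto
  show "sleq m c x" if "c \<in> m x ` set ys" for c
    using that assms by (auto simp: sleq_meet_left subset_iff)
  show "\<exists>c\<in>m x ` set ys. m w c \<noteq> z" if w: "w \<in> P" "w \<noteq> z \<and> sleq m w x" for w
  proof -
    obtain y where y: "y \<in> set ys" "m w y \<noteq> z"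
      using assms(3)[of w] w by blast
    \<comment> \<open>Passing from \<open>y\<close> to \<open>m x y\<close> puts the covering
      elements below \<open>x\<close>, and below \<open>x\<close> it changes no meet.\<close>
    then have "m w (m x y) = m w y"
      using w assms(1,2) meet_assoc[of w x y] by (auto simp: sleq_def)
    then show ?thesis using y by (metis imageI)
  qed
qed

text \<open>If \<open>\<xi>\<close> misses a cover \<open>C\<close> of \<open>x\<close>, the
  conditions \<open>x : C\<close> define a neighbourhood of \<open>\<xi>\<close>; an ultrafilter in
  it would contain a nonzero element below \<open>x\<close> disjoint from all of \<open>C\<close>.
  Conversely, for a basic neighbourhood \<open>x : ys\<close> of \<open>\<xi>\<close>, the meets of
  \<open>x\<close> with \<open>ys\<close> are not in \<open>\<xi>\<close> and so do not cover
  \<open>x\<close>; an ultrafilter through an uncovered \<open>w\<close> lies in that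
  neighbourhood.\<close>

theorem tight_iff:
  "\<xi> \<in> tight P m \<longleftrightarrow>
     \<xi> \<in> filters P m \<and> (\<forall>x\<in>\<xi>. \<forall>C. finite_cover P m z x C \<longrightarrow> C \<inter> \<xi> \<noteq> {})"
proof (intro iffI conjI ballI allI impI)
  assume t: "\<xi> \<in> tight P m"
  then show "\<xi> \<in> filters P m"
    unfolding tight_def in_closure_of by simp
  then have \<xi>P: "\<xi> \<subseteq> P"
    by (simp add: filters_iff)
  fix x C assume x: "x \<in> \<xi>" and C: "finite_cover P m z x C"
  show "C \<inter> \<xi> \<noteq> {}"
  proof
    assume dis: "C \<inter> \<xi> = {}"
    obtain ys where ys: "set ys = C"
      using C finite_list[of C] by (auto simp: finite_cover_def)
    let ?U = "{F \<in> filters P m. x \<in> F \<and> (\<forall>y\<in>set ys. y \<notin> F)}"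
    have "openin (filter_topology P m) ?U"
      using x \<xi>P ys C by (intro openin_filter_basic) (auto simp: finite_cover_def)
    moreover have "\<xi> \<in> ?U"
      using \<open>\<xi> \<in> filters P m\<close> x dis ys by auto
    ultimately obtain F where F: "F \<in> ultrafilters P m" "F \<in> ?U"
      using t unfolding tight_def in_closure_of by meson
    then obtain y where y: "y \<in> F" "sleq m y x" "\<forall>c\<in>C. m y c = z"
      using ultrafilter_disjoint_finite[of F x C] C ys unfolding finite_cover_def by blast
    then have "y \<in> P" "y \<noteq> z"
      using F by (auto simp: filters_iff)
    then show False
      using y C unfolding finite_cover_def by blast
  qed
next
  assume A: "\<xi> \<in> filters P m \<and> (\<forall>x\<in>\<xi>. \<forall>C. finite_cover P m z x C \<longrightarrow> C \<inter> \<xi> \<noteq> {})"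
  then have \<xi>P: "\<xi> \<subseteq> P"
    by (simp add: filters_iff)
  have "\<exists>F. F \<in> ultrafilters P m \<and> F \<in> U" if U: "\<xi> \<in> U" "openin (filter_topology P m) U" for U
  proof -
    obtain x ys where xy: "x \<in> \<xi>" "set ys \<subseteq> P - \<xi>"
      "{F \<in> filters P m. x \<in> F \<and> (\<forall>y\<in>set ys. y \<notin> F)} \<subseteq> U"
      using filter_topology_basis[OF U(2,1)] by blast
    have "x \<in> P"
      using xy \<xi>P by auto
    have "m x ` set ys \<inter> \<xi> = {}"
      using A xy \<open>x \<in> P\<close> filter_meet_iff[of \<xi> x] by blast
    then have "\<not> finite_cover P m z x (m x ` set ys)"
      using A xy by blast
    then obtain w where w: "w \<in> P" "w \<noteq> z" "sleq m w x" "\<forall>y\<in>set ys. m w y = z"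
      using finite_coverI_meets[of x ys] \<open>x \<in> P\<close> xy by blast
    obtain F where F: "F \<in> ultrafilters P m" "w \<in> F"
      using ultrafilter_containing w by blast
    then have Ff: "F \<in> filters P m"
      by (simp add: ultrafilters_def)
    then have "x \<in> F"
      using F w \<open>x \<in> P\<close> by (auto simp: filters_iff)
    moreover have "y \<notin> F" if "y \<in> set ys" for y
      using that w F Ff by (metis filters_iff)
    ultimately show ?thesis
      using F Ff xy by blast
  qed
  then show "\<xi> \<in> tight P m"
    using A unfolding tight_def in_closure_of by simp
qed

lemma tight_imp_filter: "\<xi> \<in> tight P m \<Longrightarrow> \<xi> \<in> filters P m"
  by (simp add: tight_iff)

lemma tight_subset: "\<xi> \<in> tight P m \<Longrightarrow> \<xi> \<subseteq> P"
  by (simp add: tight_iff filters_iff)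

lemma tight_nonempty: "\<xi> \<in> tight P m \<Longrightarrow> \<xi> \<noteq> {}"
  by (simp add: tight_iff filters_iff)

lemma ultrafilter_imp_tight: "F \<in> ultrafilters P m \<Longrightarrow> F \<in> tight P m"
  unfolding tight_def by (metis (no_types, lifting) closure_of_subset subsetD
      topspace_filter_topology ultrafilters_def mem_Collect_eq subsetI)

text \<open>By Alexander's subbase theorem only covers by subbasic sets matter. The filter generated
  by \<open>x\<close> and the elements whose negative sets occur in the cover either fails to be
  proper or lies in a positive member of the cover (or in the whole space); each case uses only
  finitely many elements and so yields a finite subcover.\<close>

lemma compactin_filters_containing:
  assumes x: "x \<in> P"
  shows "compactin (filter_topology P m) {F \<in> filters P m. x \<in> F}"
proof -
  let ?U = "{F \<in> filters P m. x \<in> F}"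
  let ?B = "{filters P m} \<union> {{F \<in> filters P m. x \<in> F} | x. x \<in> P}
                    \<union> {{F \<in> filters P m. x \<notin> F} | x. x \<in> P}"
  \<comment> \<open>\<open>X\<close> is the relative topology on \<open>?U\<close>, in the form in
    which Alexander's theorem produces it; compactness then passes to the filter space through
    continuity of the identity.\<close>
  define X where "X = topology (arbitrary union_of (finite intersection_of (\<lambda>b. b \<in> ?B) relative_to ?U))"
  have top: "topspace X = ?U"
    unfolding X_def by simp
  have "compact_space X"
  proof (rule Alexander_subbase_alt[OF _ _ X_def[symmetric]])
    show "?U \<subseteq> \<Union>?B"
      by auto
    fix C assume C: "C \<subseteq> ?B" "?U \<subseteq> \<Union>C"
    let ?N = "\<lambda>b. {F \<in> filters P m. b \<notin> F}"
    define B where "B = {b \<in> P. ?N b \<in> C}"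
    \<comment> \<open>Being a filter is a Horn condition, so the elements forced into every filter containing
      \<open>x\<close> and finitely many elements of \<open>B\<close> are themselves closed upwards and under meets.\<close>
    define ent where "ent D p \<longleftrightarrow> (\<forall>F\<in>filters P m. x \<in> F \<and> D \<subseteq> F \<longrightarrow> p \<in> F)" for D p
    define \<Xi> where "\<Xi> = {p \<in> P. \<exists>D. finite D \<and> D \<subseteq> B \<and> ent D p}"
    have \<Xi>I: "p \<in> \<Xi>" if "p \<in> P" "finite D" "D \<subseteq> B" "ent D p" for p D
      using that by (auto simp: \<Xi>_def)
    have \<Xi>E: "\<exists>D. finite D \<and> D \<subseteq> B \<and> ent D p" if "p \<in> \<Xi>" for p
      using that by (simp add: \<Xi>_def)
    have finN: "finite (?N ` D) \<and> ?N ` D \<subseteq> C" if "finite D" "D \<subseteq> B" for D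
    proof
      show "finite (?N ` D)"
        using that by simp
      show "?N ` D \<subseteq> C"
      proof (rule image_subsetI)
        fix b assume "b \<in> D"
        then have "b \<in> B" using that by blast
        then show "?N b \<in> C" by (simp add: B_def)
      qed
    qed
    show "\<exists>C'. finite C' \<and> C' \<subseteq> C \<and> ?U \<subseteq> \<Union>C'"
    proof (cases "z \<in> \<Xi>")
      case True
      then obtain D where D: "finite D" "D \<subseteq> B" "ent D z"
        using \<Xi>E by meson
      \<comment> \<open>No filter contains \<open>x\<close> and all of \<open>D\<close>, so each
        filter containing \<open>x\<close> misses some element of \<open>D\<close>.\<close>
      have "?U \<subseteq> \<Union>(?N ` D)"
      proof
        fix F assume F: "F \<in> ?U"
        then have "\<not> D \<subseteq> F"
          using D(3) by (auto simp: ent_def filters_iff)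
        then show "F \<in> \<Union>(?N ` D)"
          using F by auto
      qed
      then show ?thesis
        using finN[OF D(1,2)] by meson
    next
      case False
      have "x \<in> \<Xi>"
        using x by (intro \<Xi>I[of x "{}"]) (auto simp: ent_def)
      have "\<Xi> \<in> filters P m"
        unfolding filters_iff
      proof (intro conjI ballI impI)
        show "\<Xi> \<noteq> {}" "\<Xi> \<subseteq> P" "z \<notin> \<Xi>"
          using \<open>x \<in> \<Xi>\<close> False by (auto simp: \<Xi>_def)
      next
        fix p q assume p: "p \<in> \<Xi>" "q \<in> P" "sleq m p q"
        then obtain D where "finite D" "D \<subseteq> B" and D: "ent D p"
          using \<Xi>E by meson
        moreover have "ent D q"
          unfolding ent_def
        proof (intro ballI impI)
          fix F assume F: "F \<in> filters P m" "x \<in> F \<and> D \<subseteq> F"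
          then have "p \<in> F" using D by (simp add: ent_def)
          then show "q \<in> F" using F(1) p by (simp add: filters_iff)
        qed
        ultimately show "q \<in> \<Xi>"
          using p(2) \<Xi>I by meson
      next
        fix p q assume pq: "p \<in> \<Xi>" "q \<in> \<Xi>"
        then obtain D D' where D: "finite D" "D \<subseteq> B" "ent D p" "finite D'" "D' \<subseteq> B" "ent D' q"
          using \<Xi>E by meson
        have P: "p \<in> P" "q \<in> P"
          using pq by (auto simp: \<Xi>_def)
        then have "ent (D \<union> D') (m p q)"
          using D by (simp add: ent_def filter_meet_iff)
        then show "m p q \<in> \<Xi>"
          using D P by (intro \<Xi>I[of _ "D \<union> D'"]) auto
      qed
      then have "\<Xi> \<in> ?U"
        using \<open>x \<in> \<Xi>\<close> by simp
      \<comment> \<open>The cover is now tested on \<open>\<Xi>\<close> itself. A negative set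
        \<open>?N b\<close> of the cover cannot contain it, since \<open>b\<close> is then in
        \<open>B\<close> and hence in \<open>\<Xi>\<close>.\<close>
      then have "\<Xi> \<in> \<Union>C"
        using C(2) by (rule subsetD[rotated])
      then obtain c where c: "c \<in> C" "\<Xi> \<in> c"
        by (rule UnionE)
      have "c \<in> ?B"
        using c(1) C(1) by (rule subsetD[rotated])
      then consider "c = filters P m"
        | a where "a \<in> P" "c = {F \<in> filters P m. a \<in> F}" | b where "b \<in> P" "c = ?N b"
        by auto
      then show ?thesis
      proof cases
        case 1
        then show ?thesis using c by (intro exI[of _ "{c}"]) auto
      next
        case 2
        then have "a \<in> \<Xi>"
          using c by simp
        then obtain D where D: "finite D" "D \<subseteq> B" "ent D a"
          using \<Xi>E by meson
        \<comment> \<open>A filter containing \<open>x\<close> either contains \<open>D\<close>,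
          which forces \<open>a\<close> into it, or misses an element of \<open>D\<close>.\<close>
        have "?U \<subseteq> \<Union>(insert c (?N ` D))"
        proof
          fix F assume F: "F \<in> ?U"
          then show "F \<in> \<Union>(insert c (?N ` D))"
            using D(3) 2 by (cases "D \<subseteq> F") (auto simp: ent_def)
        qed
        moreover have "insert c (?N ` D) \<subseteq> C" "finite (insert c (?N ` D))"
          using finN[OF D(1,2)] c by auto
        ultimately show ?thesis
          by meson
      next
        case 3
        then have "b \<in> B"
          using c by (simp add: B_def)
        then have "b \<in> \<Xi>"
          using 3 by (intro \<Xi>I[of _ "{b}"]) (auto simp: ent_def)
        then show ?thesis
          using c 3 by simp
      qed
    qed
  qed
  moreover have "continuous_map X (filter_topology P m) (\<lambda>F. F)"
    unfolding filter_topology_def continuous_on_generated_topo_iff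
  proof (intro conjI allI impI)
    fix b assume b: "b \<in> ?B"
    have "(arbitrary union_of (finite intersection_of (\<lambda>b. b \<in> ?B) relative_to ?U)) (?U \<inter> b)"
      by (intro arbitrary_union_of_inc relative_to_inc finite_intersection_of_inc b)
    then have "openin X (?U \<inter> b)"
      unfolding X_def openin_subbase .
    then show "openin X ((\<lambda>F. F) -` b \<inter> topspace X)"
      unfolding top by (simp add: Int_commute)
  next
    show "(\<lambda>F. F) ` topspace X \<subseteq> \<Union>?B"
      unfolding top by auto
  qed
  ultimately have "compactin (filter_topology P m) ((\<lambda>F. F) ` topspace X)"
    unfolding compact_space_def by (rule image_compactin)
  then show ?thesis
    unfolding top by simp
qed

section \<open>Compact open sets of tight filters\<close>

abbreviation tight_union :: "('a \<times> 'a list) set \<Rightarrow> 'a set set" where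
  "tight_union A \<equiv> (\<Union>(x, ys)\<in>A. Vset P m x ys)"

lemma openin_Vset:
  assumes "x \<in> P" "set ys \<subseteq> P"
  shows "openin (subtopology (filter_topology P m) (tight P m)) (Vset P m x ys)"
proof -
  have "Vset P m x ys = {F \<in> filters P m. x \<in> F \<and> (\<forall>y\<in>set ys. y \<notin> F)} \<inter> tight P m"
    unfolding Vset_def by (auto simp: tight_iff)
  then show ?thesis
    using openin_filter_basic[OF assms] openin_subtopology by blast
qed

text \<open>The tight filters form a closed set, and excluding \<open>ys\<close> removes open sets;
  what remains meets the compact set of filters containing \<open>x\<close> in a compact
  set.\<close>

lemma Vset_in_Tc:
  assumes "x \<in> P" "set ys \<subseteq> P"
  shows "Vset P m x ys \<in> Tc P m"
proof -
  let ?X = "filter_topology P m"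
  have "openin ?X {F \<in> filters P m. y \<in> F}" if "y \<in> P" for y
    using openin_filter_basic[of y "[]"] that by simp
  then have "openin ?X (\<Union>y\<in>set ys. {F \<in> filters P m. y \<in> F})"
    using assms by (intro openin_Union) auto
  moreover have "closedin ?X (tight P m)"
    unfolding tight_def by (rule closedin_closure_of)
  ultimately have "closedin ?X (tight P m - (\<Union>y\<in>set ys. {F \<in> filters P m. y \<in> F}))"
    by (intro closedin_diff)
  then have "compactin ?X ((tight P m - (\<Union>y\<in>set ys. {F \<in> filters P m. y \<in> F}))
      \<inter> {F \<in> filters P m. x \<in> F})"
    using compactin_filters_containing[OF assms(1)] by (rule closed_Int_compactin)
  moreover have "(tight P m - (\<Union>y\<in>set ys. {F \<in> filters P m. y \<in> F})) \<inter> {F \<in> filters P m. x \<in> F}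
      = Vset P m x ys"
    unfolding Vset_def by (auto simp: tight_iff)
  ultimately have "compactin ?X (Vset P m x ys)"
    by simp
  then show ?thesis
    using openin_Vset[OF assms] unfolding Tc_def compactin_subtopology Vset_def by auto
qed

lemma Tc_Un: "\<lbrakk>U \<in> Tc P m; V \<in> Tc P m\<rbrakk> \<Longrightarrow> U \<union> V \<in> Tc P m"
  by (simp add: Tc_def compactin_Un openin_Un)

lemma Tc_empty [simp]: "{} \<in> Tc P m"
  by (simp add: Tc_def)

lemma Tc_Union: "\<lbrakk>finite K; K \<subseteq> Tc P m\<rbrakk> \<Longrightarrow> \<Union>K \<in> Tc P m"
  by (induction K rule: finite_induct) (auto simp: Tc_Un)

lemma tight_union_in_Tc:
  assumes "finite A" "A \<subseteq> P \<times> lists P"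
  shows "tight_union A \<in> Tc P m"
proof (rule Tc_Union)
  show "finite ((\<lambda>(x, ys). Vset P m x ys) ` A)"
    using assms by simp
  show "(\<lambda>(x, ys). Vset P m x ys) ` A \<subseteq> Tc P m"
    using assms(2) by (auto intro!: Vset_in_Tc)
qed

text \<open>Compactness is applied to the cover of \<open>U\<close> by all basic sets inside
  \<open>U\<close>. Maps on compact open sets can then be studied on basic sets alone.\<close>

lemma Tc_obtain:
  assumes "U \<in> Tc P m"
  obtains A where "finite A" "A \<subseteq> P \<times> lists P" "U = tight_union A"
proof -
  let ?X = "subtopology (filter_topology P m) (tight P m)"
  let ?A = "{(x, ys). x \<in> P \<and> ys \<in> lists P \<and> Vset P m x ys \<subseteq> U}"
  have o: "openin ?X U" and c: "compactin ?X U"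
    using assms by (auto simp: Tc_def)
  have "U \<subseteq> tight_union ?A"
  proof
    fix \<xi> assume \<xi>: "\<xi> \<in> U"
    obtain T where T: "openin (filter_topology P m) T" "U = T \<inter> tight P m"
      using o unfolding openin_subtopology by blast
    obtain x ys where xy: "x \<in> \<xi>" "set ys \<subseteq> P - \<xi>"
      "{F \<in> filters P m. x \<in> F \<and> (\<forall>y\<in>set ys. y \<notin> F)} \<subseteq> T"
      using filter_topology_basis[OF T(1), of \<xi>] T \<xi> by blast
    have t: "\<xi> \<in> tight P m"
      using T \<xi> by blast
    then have "x \<in> P"
      using xy tight_subset by blast
    moreover have "Vset P m x ys \<subseteq> U"
      using xy T by (auto simp: Vset_def tight_iff)
    moreover have "\<xi> \<in> Vset P m x ys"
      using xy t by (auto simp: Vset_def)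
    moreover have "ys \<in> lists P"
      using xy by auto
    ultimately show "\<xi> \<in> tight_union ?A"
      by blast
  qed
  moreover have "\<forall>V\<in>(\<lambda>(x, ys). Vset P m x ys) ` ?A. openin ?X V"
    by (auto intro!: openin_Vset)
  ultimately obtain K where K: "finite K" "K \<subseteq> (\<lambda>(x, ys). Vset P m x ys) ` ?A" "U \<subseteq> \<Union>K"
    using c unfolding compactin_def by meson
  then obtain A where A: "A \<subseteq> ?A" "finite A" "K = (\<lambda>(x, ys). Vset P m x ys) ` A"
    by (meson finite_subset_image)
  then have "U = tight_union A"
    using K(3) by blast
  moreover have "A \<subseteq> P \<times> lists P"
    using A by auto
  ultimately show ?thesis
    using that A by blast
qed

text \<open>The space of tight filters is Hausdorff, so the compact set \<open>V\<close> is closed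
  and \<open>U - V\<close> is open; as \<open>V\<close> is open, \<open>U - V\<close> is also closed
  in the compact set \<open>U\<close>.\<close>

lemma Tc_Diff:
  assumes "U \<in> Tc P m" "V \<in> Tc P m"
  shows "U - V \<in> Tc P m"
proof -
  let ?X = "subtopology (filter_topology P m) (tight P m)"
  have "Hausdorff_space ?X"
    unfolding Hausdorff_space_def
  proof (intro allI impI)
    have sep: "\<exists>U V. openin ?X U \<and> openin ?X V \<and> \<xi> \<in> U \<and> \<eta> \<in> V \<and> disjnt U V"
      if t: "\<xi> \<in> tight P m" "\<eta> \<in> tight P m" and x: "x \<in> \<xi>" "x \<notin> \<eta>" for \<xi> \<eta> x
    proof -
      \<comment> \<open>The condition of missing \<open>x\<close> has to be joined with a positive
        one to form a \<open>Vset\<close>; \<open>w\<close> provides it.\<close>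
      obtain w where w: "w \<in> \<eta>"
        using tight_nonempty t by blast
      have P: "x \<in> P" "w \<in> P"
        using tight_subset t x w by blast+
      then have "openin ?X (Vset P m x [])" "openin ?X (Vset P m w [x])"
        by (auto intro!: openin_Vset)
      moreover have "\<xi> \<in> Vset P m x []" "\<eta> \<in> Vset P m w [x]"
        using t x w by (auto simp: Vset_def)
      moreover have "disjnt (Vset P m x []) (Vset P m w [x])"
        by (auto simp: Vset_def disjnt_def)
      ultimately show ?thesis by blast
    qed
    fix \<xi> \<eta> assume A: "\<xi> \<in> topspace ?X \<and> \<eta> \<in> topspace ?X \<and> \<xi> \<noteq> \<eta>"
    then have t: "\<xi> \<in> tight P m" "\<eta> \<in> tight P m"
      by auto
    from A obtain x where "x \<in> \<xi> \<and> x \<notin> \<eta> \<or> x \<in> \<eta> \<and> x \<notin> \<xi>"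
      by blast
    then show "\<exists>U V. openin ?X U \<and> openin ?X V \<and> \<xi> \<in> U \<and> \<eta> \<in> V \<and> disjnt U V"
      using sep[OF t] sep[OF t(2,1)] by (metis disjnt_sym)
  qed
  then have V: "closedin ?X V"
    using assms compactin_imp_closedin by (auto simp: Tc_def)
  then have "openin ?X (U - V)"
    using assms by (auto simp: Tc_def intro: openin_diff)
  moreover have "compactin ?X (U - V)"
  proof -
    have "U \<subseteq> topspace ?X"
      using assms(1) compactin_subset_topspace unfolding Tc_def by blast
    then have "U - V = (topspace ?X - V) \<inter> U"
      by blast
    moreover have "closedin ?X (topspace ?X - V)"
      using assms(2) by (intro closedin_diff closedin_topspace) (simp add: Tc_def)
    ultimately show ?thesis
      using assms(1) closed_Int_compactin by (auto simp: Tc_def)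
  qed
  ultimately show ?thesis
    by (simp add: Tc_def)
qed

lemma Tc_Int: "\<lbrakk>U \<in> Tc P m; V \<in> Tc P m\<rbrakk> \<Longrightarrow> U \<inter> V \<in> Tc P m"
  by (metis Diff_Diff_Int Tc_Diff)

text \<open>A tight filter in the set shows that the meets of \<open>x\<close> with
  \<open>ys\<close> do not cover \<open>x\<close>; conversely an ultrafilter through an uncovered
  \<open>w\<close> belongs to the set. The right-hand side mentions elements only, so it persists in
  a larger semilattice.\<close>

lemma Vset_nonempty_iff:
  assumes "x \<in> P" "set ys \<subseteq> P"
  shows "Vset P m x ys \<noteq> {} \<longleftrightarrow> (\<exists>w\<in>P. w \<noteq> z \<and> sleq m w x \<and> (\<forall>y\<in>set ys. m w y = z))"
proof
  assume "Vset P m x ys \<noteq> {}"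
  then obtain \<xi> where \<xi>: "\<xi> \<in> tight P m" "x \<in> \<xi>" "\<forall>y\<in>set ys. y \<notin> \<xi>"
    by (auto simp: Vset_def)
  then have "\<not> finite_cover P m z x (m x ` set ys)"
    using assms filter_meet_iff[of \<xi> x] unfolding tight_iff by blast
  then show "\<exists>w\<in>P. w \<noteq> z \<and> sleq m w x \<and> (\<forall>y\<in>set ys. m w y = z)"
    using finite_coverI_meets[OF assms] by blast
next
  assume "\<exists>w\<in>P. w \<noteq> z \<and> sleq m w x \<and> (\<forall>y\<in>set ys. m w y = z)"
  then obtain w where w: "w \<in> P" "w \<noteq> z" "sleq m w x" "\<forall>y\<in>set ys. m w y = z"
    by blast
  obtain F where F: "F \<in> ultrafilters P m" "w \<in> F"
    using ultrafilter_containing w by blast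
  have Ff: "F \<in> filters P m"
    using F by (simp add: ultrafilters_def)
  have "y \<notin> F" if "y \<in> set ys" for y
    using that w F Ff by (metis filters_iff)
  moreover have "x \<in> F"
    using F w assms Ff by (auto simp: filters_iff)
  ultimately have "F \<in> Vset P m x ys"
    using ultrafilter_imp_tight F by (auto simp: Vset_def)
  then show "Vset P m x ys \<noteq> {}" by blast
qed

end

section \<open>Cover-preserving inclusions and isomorphisms\<close>

lemma emb_empty: "emb P Q m {} = {}"
  and emb_Un: "emb P Q m (U \<union> V) = emb P Q m U \<union> emb P Q m V"
  and emb_Int: "emb P Q m (U \<inter> V) = emb P Q m U \<inter> emb P Q m V"
  and emb_Diff: "emb P Q m (U - V) = emb P Q m U - emb P Q m V"
  unfolding emb_def by blast+

locale cover_preserving =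
  A: semilattice_zero P m z + B: semilattice_zero Q m z
  for P Q :: "'a set" and m :: "'a \<Rightarrow> 'a \<Rightarrow> 'a" and z :: 'a +
  assumes subset: "P \<subseteq> Q"
    and covers: "preserves_finite_covers P Q m z"
begin

text \<open>A cover in \<open>P\<close> is a cover in \<open>Q\<close>, so \<open>\<xi>\<close>
  meets it, and it does so inside \<open>P\<close>.\<close>

lemma restrict_tight:
  assumes \<xi>: "\<xi> \<in> tight Q m" and ne: "\<xi> \<inter> P \<noteq> {}"
  shows "\<xi> \<inter> P \<in> tight P m"
  unfolding A.tight_iff
proof (intro conjI ballI allI impI)
  have f: "\<xi> \<in> filters Q m"
    using \<xi> by (rule B.tight_imp_filter)
  show "\<xi> \<inter> P \<in> filters P m"
    using f ne subset unfolding A.filters_iff B.filters_iff by (auto simp: subset_iff)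
next
  fix x C assume x: "x \<in> \<xi> \<inter> P" and C: "finite_cover P m z x C"
  have "finite_cover Q m z x C"
    using covers C x unfolding preserves_finite_covers_def by blast
  then have "C \<inter> \<xi> \<noteq> {}"
    using \<xi> x unfolding B.tight_iff by blast
  moreover have "C \<subseteq> P"
    using C by (simp add: finite_cover_def)
  ultimately show "C \<inter> (\<xi> \<inter> P) \<noteq> {}"
    by blast
qed

text \<open>The conditions concern elements of \<open>P\<close> only, so \<open>\<xi>\<close> and
  \<open>\<xi> \<inter> P\<close> satisfy the same ones; \<open>restrict_tight\<close> gives the
  inclusion from right to left.\<close>

lemma emb_Vset:
  assumes "x \<in> P" "set ys \<subseteq> P"
  shows "emb P Q m (Vset P m x ys) = Vset Q m x ys"
  using assms restrict_tight unfolding emb_def Vset_def by blast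

lemma emb_tight_union:
  assumes "C \<subseteq> P \<times> lists P"
  shows "emb P Q m (A.tight_union C) = B.tight_union C"
proof -
  have "emb P Q m (A.tight_union C) = (\<Union>(x, ys)\<in>C. emb P Q m (Vset P m x ys))"
    unfolding emb_def by auto
  also have "\<dots> = B.tight_union C"
  proof (intro SUP_cong refl)
    fix c assume "c \<in> C"
    then have "fst c \<in> P" "set (snd c) \<subseteq> P"
      using assms by auto
    then show "(case c of (x, ys) \<Rightarrow> emb P Q m (Vset P m x ys)) = (case c of (x, ys) \<Rightarrow> Vset Q m x ys)"
      by (simp add: split_def emb_Vset)
  qed
  finally show ?thesis .
qed

lemma emb_in_Tc:
  assumes "U \<in> Tc P m"
  shows "emb P Q m U \<in> Tc Q m"
proof -
  obtain C where C: "finite C" "C \<subseteq> P \<times> lists P" "U = A.tight_union C"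
    using A.Tc_obtain[OF assms] by blast
  have "C \<subseteq> Q \<times> lists Q"
    using C(2) subset lists_mono by blast
  then show ?thesis
    using C by (simp add: emb_tight_union B.tight_union_in_Tc)
qed

text \<open>An element of \<open>P\<close> witnessing that a basic set is nonempty is also a witness
  in \<open>Q\<close>.\<close>

lemma emb_eq_empty_iff:
  assumes "U \<in> Tc P m"
  shows "emb P Q m U = {} \<longleftrightarrow> U = {}"
proof
  assume e: "emb P Q m U = {}"
  obtain C where C: "finite C" "C \<subseteq> P \<times> lists P" "U = A.tight_union C"
    using A.Tc_obtain[OF assms] by blast
  have "Vset P m x ys = {}" if "(x, ys) \<in> C" for x ys
  proof (rule ccontr)
    have P: "x \<in> P" "set ys \<subseteq> P"
      using C(2) that by auto
    then have Q: "x \<in> Q" "set ys \<subseteq> Q"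
      using subset by auto
    assume "Vset P m x ys \<noteq> {}"
    then have "Vset Q m x ys \<noteq> {}"
      using subset unfolding A.Vset_nonempty_iff[OF P] B.Vset_nonempty_iff[OF Q] by blast
    then show False
      using e that C(2) unfolding C(3) emb_tight_union[OF C(2)] by blast
  qed
  then show "U = {}"
    using C(3) by auto
qed (simp add: emb_def)

text \<open>As \<open>emb\<close> preserves differences, injectivity reduces to its trivial
  kernel.\<close>

lemma emb_inj: "inj_on (emb P Q m) (Tc P m)"
proof (rule inj_onI)
  fix U V assume U: "U \<in> Tc P m" and V: "V \<in> Tc P m" and e: "emb P Q m U = emb P Q m V"
  have "U - V = {}" "V - U = {}"
    using e U V A.Tc_Diff emb_eq_empty_iff by (metis Diff_cancel emb_Diff)+
  then show "U = V"
    by blast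
qed

text \<open>Restriction to \<open>R\<close> may pass through \<open>P\<close>, the intermediate
  filter being tight by \<open>restrict_tight\<close>. This compares different routes from a graded
  piece to the larger semilattice.\<close>

lemma emb_emb:
  assumes "R \<subseteq> P"
  shows "emb P Q m (emb R P m U) = emb R Q m U"
proof -
  have "\<xi> \<inter> P \<inter> R = \<xi> \<inter> R" for \<xi>
    using assms by blast
  then show ?thesis
    using restrict_tight unfolding emb_def by auto
qed

end

section \<open>Ideals of a semilattice\<close>

locale semilattice_ideal = B: semilattice_zero Q m z
  for P Q :: "'a set" and m :: "'a \<Rightarrow> 'a \<Rightarrow> 'a" and z :: 'a +
  assumes ideal_subset: "P \<subseteq> Q" and ideal_zero: "z \<in> P"
    and ideal_down: "\<lbrakk>x \<in> P; y \<in> Q; sleq m y x\<rbrakk> \<Longrightarrow> y \<in> P"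
begin

lemma ideal_meet: "\<lbrakk>x \<in> P; y \<in> Q\<rbrakk> \<Longrightarrow> m x y \<in> P"
  using ideal_subset ideal_down[of x "m x y"] B.sleq_meet_left[of x y] by auto

text \<open>All elements below a member of the ideal are in the ideal, so the covering condition
  tests the same elements in \<open>P\<close> and in \<open>Q\<close>.\<close>

sublocale cover_preserving P Q m z
proof unfold_locales
  show "preserves_finite_covers P Q m z"
    unfolding preserves_finite_covers_def finite_cover_def
    using ideal_subset ideal_down by blast
qed (use ideal_subset ideal_zero in \<open>auto simp: ideal_meet subset_iff
      intro: B.meet_assoc B.meet_comm\<close>)

text \<open>This makes the image of \<open>emb\<close> an ideal of the compact open sets of
  \<open>Q\<close>; it suffices to intersect basic sets.\<close>

lemma emb_Int_image:
  assumes "U \<in> Tc P m" "V \<in> Tc Q m"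
  shows "emb P Q m U \<inter> V \<in> emb P Q m ` Tc P m"
proof -
  obtain C where C: "finite C" "C \<subseteq> P \<times> lists P" "U = A.tight_union C"
    using A.Tc_obtain[OF assms(1)] by blast
  obtain D where D: "finite D" "D \<subseteq> Q \<times> lists Q" "V = B.tight_union D"
    using B.Tc_obtain[OF assms(2)] by blast
  \<comment> \<open>Meeting the excluded elements with \<open>x\<close> moves them into
    \<open>P\<close> and leaves the set unchanged, because \<open>x\<close> is required to lie in
    the filter anyway.\<close>
  define k where "k = (\<lambda>((x, ys), (x', ys')). (m x x', map (m x) (ys @ ys')))"
  have k: "k (c, d) \<in> P \<times> lists P" if "c \<in> C" "d \<in> D" for c d
  proof -
    have "c \<in> P \<times> lists P" "d \<in> Q \<times> lists Q"
      using that C(2) D(2) by blast+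
    then show ?thesis
      using ideal_subset by (auto simp: k_def ideal_meet subset_iff)
  qed
  have kCD: "k ` (C \<times> D) \<subseteq> P \<times> lists P"
  proof (rule image_subsetI)
    fix p assume "p \<in> C \<times> D"
    then show "k p \<in> P \<times> lists P"
      using k[of "fst p" "snd p"] by (simp add: mem_Times_iff)
  qed
  have UN: "(\<Union>c\<in>C. \<Union>d\<in>D. f (k (c, d))) = (\<Union>p\<in>k ` (C \<times> D). f p)" for f :: "'a \<times> 'a list \<Rightarrow> 'a set set"
    by blast
  have meet: "Vset Q m x ys \<inter> Vset Q m x' ys' = Vset Q m (m x x') (map (m x) (ys @ ys'))"
    if "x \<in> Q" "set ys \<subseteq> Q" "x' \<in> Q" "set ys' \<subseteq> Q" for x ys x' ys'
  proof -
    have iff: "m x y \<in> \<xi> \<longleftrightarrow> x \<in> \<xi> \<and> y \<in> \<xi>" if "\<xi> \<in> tight Q m" "y \<in> Q" for \<xi> y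
      using B.filter_meet_iff[OF B.tight_imp_filter] that \<open>x \<in> Q\<close> by blast
    have "(\<forall>y\<in>set (map (m x) (ys @ ys')). y \<notin> \<xi>) \<longleftrightarrow> (\<forall>y\<in>set ys \<union> set ys'. \<not> (x \<in> \<xi> \<and> y \<in> \<xi>))"
      if "\<xi> \<in> tight Q m" for \<xi>
    proof -
      have "\<forall>y\<in>set (ys @ ys'). m x y \<in> \<xi> \<longleftrightarrow> x \<in> \<xi> \<and> y \<in> \<xi>"
        using iff[OF that] \<open>set ys \<subseteq> Q\<close> \<open>set ys' \<subseteq> Q\<close> by (simp add: subset_iff ball_Un)
      then show ?thesis
        unfolding set_map set_append by blast
    qed
    then show ?thesis
      unfolding Vset_def using iff[of _ x'] \<open>x' \<in> Q\<close> by blast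
  qed
  have "emb P Q m U \<inter> V = (\<Union>c\<in>C. \<Union>d\<in>D. (case c of (x, ys) \<Rightarrow> Vset Q m x ys) \<inter>
      (case d of (x, ys) \<Rightarrow> Vset Q m x ys))"
    unfolding C(3) D(3) emb_tight_union[OF C(2)] by blast
  also have "\<dots> = (\<Union>c\<in>C. \<Union>d\<in>D. case k (c, d) of (x, ys) \<Rightarrow> Vset Q m x ys)"
  proof (intro SUP_cong refl)
    fix c d assume cd: "c \<in> C" "d \<in> D"
    obtain x ys x' ys' where e: "c = (x, ys)" "d = (x', ys')"
      by (metis surj_pair)
    have "x \<in> Q" "set ys \<subseteq> Q" "x' \<in> Q" "set ys' \<subseteq> Q"
      using cd e C(2) D(2) ideal_subset by auto
    then show "(case c of (x, ys) \<Rightarrow> Vset Q m x ys) \<inter> (case d of (x, ys) \<Rightarrow> Vset Q m x ys)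
        = (case k (c, d) of (x, ys) \<Rightarrow> Vset Q m x ys)"
      using meet by (simp add: e k_def)
  qed
  also have "\<dots> = B.tight_union (k ` (C \<times> D))"
    using UN[of "\<lambda>(x, ys). Vset Q m x ys"] .
  also have "\<dots> = emb P Q m (A.tight_union (k ` (C \<times> D)))"
    by (rule emb_tight_union[OF kCD, symmetric])
  finally show ?thesis
    using A.tight_union_in_Tc[OF _ kCD] C(1) D(1) by (simp add: image_eqI)
qed

end

section \<open>Isomorphisms of semilattices and their action on tight filters\<close>

locale semilattice_iso =
  A: semilattice_zero P m z + B: semilattice_zero Q m z
  for P Q :: "'a set" and m :: "'a \<Rightarrow> 'a \<Rightarrow> 'a" and z :: 'a +
  fixes \<theta> \<theta>' :: "'a \<Rightarrow> 'a"
  assumes map_closed [simp]: "x \<in> P \<Longrightarrow> \<theta> x \<in> Q" and inv_closed [simp]: "y \<in> Q \<Longrightarrow> \<theta>' y \<in> P"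
    and inv_map [simp]: "x \<in> P \<Longrightarrow> \<theta>' (\<theta> x) = x" and map_inv [simp]: "y \<in> Q \<Longrightarrow> \<theta> (\<theta>' y) = y"
    and map_mono: "\<lbrakk>x \<in> P; x' \<in> P; sleq m x x'\<rbrakk> \<Longrightarrow> sleq m (\<theta> x) (\<theta> x')"
    and inv_mono: "\<lbrakk>y \<in> Q; y' \<in> Q; sleq m y y'\<rbrakk> \<Longrightarrow> sleq m (\<theta>' y) (\<theta>' y')"
begin

lemma inverse_iso: "semilattice_iso Q P m z \<theta>' \<theta>"
  by unfold_locales (auto intro: map_mono inv_mono)

lemma map_inj: "inj_on \<theta> P"
  by (metis inj_onI inv_map)

lemma sleq_map_inv: "\<lbrakk>x \<in> P; y \<in> Q; sleq m (\<theta> x) y\<rbrakk> \<Longrightarrow> sleq m x (\<theta>' y)"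
  using inv_mono[of "\<theta> x" y] by simp

text \<open>Meets are greatest lower bounds, so mutually inverse monotone maps preserve them; the
  inequality from right to left is checked after applying \<open>\<theta>'\<close>.\<close>

lemma map_meet:
  assumes "x \<in> P" "y \<in> P"
  shows "\<theta> (m x y) = m (\<theta> x) (\<theta> y)"
proof (rule B.sleq_antisym)
  show "sleq m (\<theta> (m x y)) (m (\<theta> x) (\<theta> y))"
    using assms by (intro B.sleq_meetI map_mono A.sleq_meet_left A.sleq_meet_right) auto
  have "sleq m (\<theta>' (m (\<theta> x) (\<theta> y))) (\<theta>' (\<theta> x))" "sleq m (\<theta>' (m (\<theta> x) (\<theta> y))) (\<theta>' (\<theta> y))"
    using assms by (intro inv_mono B.sleq_meet_left B.sleq_meet_right; simp)+
  then have "sleq m (\<theta>' (m (\<theta> x) (\<theta> y))) (m x y)"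
    using assms by (intro A.sleq_meetI) auto
  then have "sleq m (\<theta> (\<theta>' (m (\<theta> x) (\<theta> y)))) (\<theta> (m x y))"
    using assms by (intro map_mono) auto
  then show "sleq m (m (\<theta> x) (\<theta> y)) (\<theta> (m x y))"
    using assms by simp
qed (use assms in auto)

lemma map_zero: "\<theta> z = z"
  using map_meet[of z "\<theta>' z"] by simp

lemma image_filter:
  assumes F: "F \<in> filters P m"
  shows "\<theta> ` F \<in> filters Q m"
proof -
  have FP: "F \<subseteq> P" and up: "\<And>x y. \<lbrakk>x \<in> F; y \<in> P; sleq m x y\<rbrakk> \<Longrightarrow> y \<in> F"
    using F by (auto simp: A.filters_iff)
  show ?thesis
    unfolding B.filters_iff
  proof (intro conjI ballI impI)
    show "\<theta> ` F \<noteq> {}" "\<theta> ` F \<subseteq> Q"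
      using F FP by (auto simp: A.filters_iff)
    show "z \<notin> \<theta> ` F"
    proof
      assume "z \<in> \<theta> ` F"
      then obtain x where x: "x \<in> F" "\<theta> x = z"
        by (metis imageE)
      then have "x = z"
        using map_inj map_zero FP by (metis A.zero_closed inj_onD subsetD)
      then show False
        using x F by (simp add: A.filters_iff)
    qed
  next
    fix y q assume "y \<in> \<theta> ` F" and q: "q \<in> Q" "sleq m y q"
    then obtain x where x: "x \<in> F" "y = \<theta> x"
      by blast
    then have "\<theta>' q \<in> F"
      using up[of x "\<theta>' q"] sleq_map_inv[of x q] q FP by auto
    then show "q \<in> \<theta> ` F"
      using q by (metis imageI map_inv)
  next
    fix y y' assume "y \<in> \<theta> ` F" "y' \<in> \<theta> ` F"
    then obtain x x' where x: "x \<in> F" "y = \<theta> x" "x' \<in> F" "y' = \<theta> x'"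
      by blast
    then have "m y y' = \<theta> (m x x')"
      using FP map_meet[of x x'] by (simp add: subset_iff)
    moreover have "m x x' \<in> F"
      using F x by (simp add: A.filters_iff)
    ultimately show "m y y' \<in> \<theta> ` F"
      by blast
  qed
qed

text \<open>The inverse isomorphism also preserves meets and \<open>z\<close>, so it turns a nonzero
  meet \<open>m (\<theta> y) c\<close> into a nonzero meet of \<open>y\<close> with
  \<open>\<theta>' c\<close>.\<close>

lemma finite_cover_inv:
  assumes x: "x \<in> P" and C: "finite_cover Q m z (\<theta> x) C"
  shows "finite_cover P m z x (\<theta>' ` C)"
  unfolding finite_cover_def
proof (intro conjI ballI impI)
  interpret I: semilattice_iso Q P m z \<theta>' \<theta> by (rule inverse_iso)
  have CQ: "C \<subseteq> Q"
    using C by (simp add: finite_cover_def)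
  show "finite (\<theta>' ` C)" "\<theta>' ` C \<subseteq> P"
    using C CQ by (auto simp: finite_cover_def)
  show "sleq m c x" if "c \<in> \<theta>' ` C" for c
  proof -
    obtain d where d: "d \<in> C" "c = \<theta>' d"
      using \<open>c \<in> \<theta>' ` C\<close> by blast
    then show ?thesis
      using inv_mono[of d "\<theta> x"] C x CQ by (auto simp: finite_cover_def)
  qed
  fix y assume y: "y \<in> P" "y \<noteq> z \<and> sleq m y x"
  have "\<theta> y \<noteq> z"
    using y map_inj map_zero by (metis A.zero_closed inj_onD)
  then obtain c where c: "c \<in> C" "m (\<theta> y) c \<noteq> z"
    using C map_mono[of y x] x y map_closed[of y] unfolding finite_cover_def by blast
  have "m y (\<theta>' c) = \<theta>' (m (\<theta> y) c)"
    using c y CQ I.map_meet[of "\<theta> y" c] by auto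
  moreover have "\<theta>' (m (\<theta> y) c) \<noteq> z"
    using c y CQ I.map_inj I.map_zero by (metis B.meet_closed B.zero_closed inj_onD map_closed subsetD)
  ultimately show "\<exists>c\<in>\<theta>' ` C. m y c \<noteq> z"
    using c by (metis imageI)
qed

text \<open>A cover of \<open>\<theta> x\<close> pulls back to a cover of \<open>x\<close>, which
  \<open>\<xi>\<close> meets.\<close>

lemma image_tight:
  assumes \<xi>: "\<xi> \<in> tight P m"
  shows "\<theta> ` \<xi> \<in> tight Q m"
  unfolding B.tight_iff
proof (intro conjI ballI allI impI)
  show "\<theta> ` \<xi> \<in> filters Q m"
    using \<xi> by (intro image_filter A.tight_imp_filter)
  fix y C assume "y \<in> \<theta> ` \<xi>" and C: "finite_cover Q m z y C"
  then obtain x where x: "x \<in> \<xi>" "y = \<theta> x"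
    by blast
  then have "x \<in> P"
    using A.tight_subset \<xi> by blast
  then have "\<theta>' ` C \<inter> \<xi> \<noteq> {}"
    using finite_cover_inv[of x C] C x \<xi> unfolding A.tight_iff by blast
  then obtain c where c: "c \<in> C" "\<theta>' c \<in> \<xi>"
    by blast
  moreover have "c \<in> Q"
    using C c by (auto simp: finite_cover_def)
  ultimately show "C \<inter> \<theta> ` \<xi> \<noteq> {}"
    by (metis IntI emptyE imageI map_inv)
qed

lemma image_image_inv: "\<eta> \<subseteq> Q \<Longrightarrow> \<theta> ` \<theta>' ` \<eta> = \<eta>"
  by (force simp: image_image subset_iff)

text \<open>Surjectivity comes from the inverse isomorphism, which sends tight filters of
  \<open>Q\<close> back to tight filters of \<open>P\<close>.\<close>

lemma image_Vset:
  assumes "x \<in> P" "set ys \<subseteq> P"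
  shows "(\<lambda>\<xi>. \<theta> ` \<xi>) ` Vset P m x ys = Vset Q m (\<theta> x) (map \<theta> ys)"
proof -
  interpret I: semilattice_iso Q P m z \<theta>' \<theta> by (rule inverse_iso)
  have mem: "\<theta> p \<in> \<theta> ` \<xi> \<longleftrightarrow> p \<in> \<xi>" if "\<xi> \<in> tight P m" "p \<in> P" for \<xi> p
    using inj_on_image_mem_iff[OF map_inj] that A.tight_subset by blast
  have iff: "\<theta> ` \<xi> \<in> Vset Q m (\<theta> x) (map \<theta> ys) \<longleftrightarrow> \<xi> \<in> Vset P m x ys" if "\<xi> \<in> tight P m" for \<xi>
    using that assms image_tight[OF that] mem[OF that] by (auto simp: Vset_def subset_iff)
  show ?thesis
  proof
    show "(\<lambda>\<xi>. \<theta> ` \<xi>) ` Vset P m x ys \<subseteq> Vset Q m (\<theta> x) (map \<theta> ys)"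
      using iff unfolding Vset_def[of P] by blast
    show "Vset Q m (\<theta> x) (map \<theta> ys) \<subseteq> (\<lambda>\<xi>. \<theta> ` \<xi>) ` Vset P m x ys"
    proof
      fix \<eta> assume \<eta>: "\<eta> \<in> Vset Q m (\<theta> x) (map \<theta> ys)"
      then have t: "\<eta> \<in> tight Q m"
        by (simp add: Vset_def)
      then have e: "\<theta> ` \<theta>' ` \<eta> = \<eta>"
        using image_image_inv B.tight_subset by blast
      have "\<theta>' ` \<eta> \<in> Vset P m x ys"
        using iff[OF I.image_tight[OF t]] \<eta> e by simp
      then show "\<eta> \<in> (\<lambda>\<xi>. \<theta> ` \<xi>) ` Vset P m x ys"
        using e by (metis imageI)
    qed
  qed
qed

text \<open>The description by finite unions of basic sets reduces this to
  \<open>image_Vset\<close>.\<close>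

lemma image_Tc:
  assumes "U \<in> Tc P m"
  shows "(\<lambda>\<xi>. \<theta> ` \<xi>) ` U \<in> Tc Q m"
proof -
  obtain C where C: "finite C" "C \<subseteq> P \<times> lists P" "U = A.tight_union C"
    using A.Tc_obtain[OF assms] by blast
  let ?D = "(\<lambda>(x, ys). (\<theta> x, map \<theta> ys)) ` C"
  have "(\<lambda>\<xi>. \<theta> ` \<xi>) ` U = (\<Union>(x, ys)\<in>C. (\<lambda>\<xi>. \<theta> ` \<xi>) ` Vset P m x ys)"
    unfolding C(3) by (simp add: image_UN split_def)
  also have "\<dots> = (\<Union>(x, ys)\<in>C. Vset Q m (\<theta> x) (map \<theta> ys))"
  proof (intro SUP_cong refl)
    fix c assume "c \<in> C"
    then have "fst c \<in> P" "set (snd c) \<subseteq> P"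
      using C(2) by auto
    then show "(case c of (x, ys) \<Rightarrow> (\<lambda>\<xi>. \<theta> ` \<xi>) ` Vset P m x ys)
        = (case c of (x, ys) \<Rightarrow> Vset Q m (\<theta> x) (map \<theta> ys))"
      by (simp add: split_def image_Vset)
  qed
  also have "\<dots> = B.tight_union ?D"
    by (simp add: image_image split_def)
  also have "\<dots> \<in> Tc Q m"
    using C(1) by (intro B.tight_union_in_Tc) (auto dest!: subsetD[OF C(2)])
  finally show ?thesis .
qed

end

text \<open>Naturality of \<open>emb\<close>: if \<open>\<theta>2\<close> extends
  \<open>\<theta>1\<close>, then restricting a tight filter and transporting it commute. It is the
  source of equivariance later.\<close>

lemma image_emb:
  assumes 1: "semilattice_iso P1 Q1 m z \<theta>1 \<theta>1'" and 2: "semilattice_iso P2 Q2 m z \<theta>2 \<theta>2'"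
    and sub: "P1 \<subseteq> P2" and ext: "\<And>x. x \<in> P1 \<Longrightarrow> \<theta>2 x = \<theta>1 x"
    and U: "U \<subseteq> tight P1 m"
  shows "(\<lambda>\<xi>. \<theta>2 ` \<xi>) ` emb P1 P2 m U = emb Q1 Q2 m ((\<lambda>\<xi>. \<theta>1 ` \<xi>) ` U)"
proof -
  interpret A: semilattice_iso P1 Q1 m z \<theta>1 \<theta>1' by (rule 1)
  interpret B: semilattice_iso P2 Q2 m z \<theta>2 \<theta>2' by (rule 2)
  interpret B': semilattice_iso Q2 P2 m z \<theta>2' \<theta>2 by (rule B.inverse_iso)
  have im: "\<theta>2 ` \<xi> \<inter> Q1 = \<theta>1 ` (\<xi> \<inter> P1)" if "\<xi> \<in> tight P2 m" for \<xi>
  proof -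
    have sub2: "\<xi> \<subseteq> P2"
      using that B.A.tight_subset by blast
    show ?thesis
    proof (intro equalityI subsetI)
      fix y assume "y \<in> \<theta>2 ` \<xi> \<inter> Q1"
      then obtain x where x: "x \<in> \<xi>" "y = \<theta>2 x" "y \<in> Q1"
        by blast
      \<comment> \<open>Both sides equal \<open>y\<close>; injectivity of \<open>\<theta>2\<close>
        then shows that the preimage \<open>x\<close> already lies in \<open>P1\<close>.\<close>
      have "\<theta>2 (\<theta>1' y) = \<theta>2 x"
        using x ext[of "\<theta>1' y"] by simp
      then have "\<theta>1' y = x"
        using x sub2 sub B.map_inj by (meson A.inv_closed inj_onD subsetD)
      then show "y \<in> \<theta>1 ` (\<xi> \<inter> P1)"
        using x by (metis A.inv_closed A.map_inv IntI imageI)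
    next
      fix y assume "y \<in> \<theta>1 ` (\<xi> \<inter> P1)"
      then obtain x where x: "x \<in> \<xi>" "x \<in> P1" "y = \<theta>1 x"
        by blast
      then show "y \<in> \<theta>2 ` \<xi> \<inter> Q1"
        using ext[of x] by (auto intro!: image_eqI[of _ _ x])
    qed
  qed
  show ?thesis
  proof (intro equalityI subsetI)
    fix \<eta> assume "\<eta> \<in> (\<lambda>\<xi>. \<theta>2 ` \<xi>) ` emb P1 P2 m U"
    then obtain \<xi> where \<xi>: "\<xi> \<in> tight P2 m" "\<xi> \<inter> P1 \<noteq> {}" "\<xi> \<inter> P1 \<in> U" "\<eta> = \<theta>2 ` \<xi>"
      unfolding emb_def by blast
    then show "\<eta> \<in> emb Q1 Q2 m ((\<lambda>\<xi>. \<theta>1 ` \<xi>) ` U)"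
      using B.image_tight im unfolding emb_def by simp
  next
    fix \<eta> assume "\<eta> \<in> emb Q1 Q2 m ((\<lambda>\<xi>. \<theta>1 ` \<xi>) ` U)"
    then obtain \<xi>1 where \<eta>: "\<eta> \<in> tight Q2 m" "\<eta> \<inter> Q1 \<noteq> {}" and \<xi>1: "\<xi>1 \<in> U" "\<eta> \<inter> Q1 = \<theta>1 ` \<xi>1"
      unfolding emb_def by blast
    \<comment> \<open>The preimage is found by transporting \<open>\<eta>\<close> back; its
      restriction to \<open>P1\<close> is \<open>\<xi>1\<close> because \<open>\<theta>1\<close> is
      injective on subsets of \<open>P1\<close>.\<close>
    define \<xi> where "\<xi> = \<theta>2' ` \<eta>"
    have \<xi>: "\<xi> \<in> tight P2 m"
      unfolding \<xi>_def using \<eta> by (intro B'.image_tight)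
    have e: "\<theta>2 ` \<xi> = \<eta>"
      unfolding \<xi>_def using \<eta> B.B.tight_subset by (intro B.image_image_inv) blast
    have "\<xi>1 \<subseteq> P1"
      using \<xi>1 U A.A.tight_subset by blast
    moreover have "\<theta>1 ` (\<xi> \<inter> P1) = \<theta>1 ` \<xi>1"
      using im[OF \<xi>] e \<xi>1 by simp
    ultimately have "\<xi> \<inter> P1 = \<xi>1"
      using inj_on_image_eq_iff[OF A.map_inj, of "\<xi> \<inter> P1" \<xi>1] by simp
    moreover have "\<xi>1 \<noteq> {}"
      using \<xi>1 \<eta> by auto
    ultimately have "\<xi> \<in> emb P1 P2 m U"
      using \<xi> \<xi>1 by (simp add: emb_def)
    then show "\<eta> \<in> (\<lambda>\<xi>. \<theta>2 ` \<xi>) ` emb P1 P2 m U"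
      using e by (metis imageI)
  qed
qed

section \<open>Graded inverse semigroups\<close>

locale inv_semigroup =
  fixes S :: "'a set" and m :: "'a \<Rightarrow> 'a \<Rightarrow> 'a" and z :: 'a
  assumes inverse_semigroup: "inverse_semigroup_zero S m z"
begin

abbreviation star :: "'a \<Rightarrow> 'a" where "star \<equiv> sinv S m"

lemma zero_in [simp]: "z \<in> S"
  and mult_closed [simp]: "\<And>x y. \<lbrakk>x \<in> S; y \<in> S\<rbrakk> \<Longrightarrow> m x y \<in> S"
  and mult_assoc: "\<And>x y w. \<lbrakk>x \<in> S; y \<in> S; w \<in> S\<rbrakk> \<Longrightarrow> m (m x y) w = m x (m y w)"
  and mult_zero_left [simp]: "\<And>x. x \<in> S \<Longrightarrow> m z x = z"
  and mult_zero_right [simp]: "\<And>x. x \<in> S \<Longrightarrow> m x z = z"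
  and ex1_inverse: "\<And>s. s \<in> S \<Longrightarrow> \<exists>!t. t \<in> S \<and> m (m s t) s = s \<and> m (m t s) t = t"
  using inverse_semigroup unfolding inverse_semigroup_zero_def by (elim conjE; simp)+

lemma star_props:
  assumes "s \<in> S"
  shows "star s \<in> S" "m (m s (star s)) s = s" "m (m (star s) s) (star s) = star s"
  using theI'[OF ex1_inverse[OF assms]] unfolding sinv_def by blast+

lemma star_closed [simp]: "s \<in> S \<Longrightarrow> star s \<in> S"
  by (rule star_props)

lemma star_unique: "\<lbrakk>s \<in> S; t \<in> S; m (m s t) s = s; m (m t s) t = t\<rbrakk> \<Longrightarrow> star s = t"
  using ex1_inverse[of s] star_props[of s] by blast

lemma star_mult [simp]: "s \<in> S \<Longrightarrow> m s (m (star s) s) = s"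
  "s \<in> S \<Longrightarrow> m (star s) (m s (star s)) = star s"
  using star_props[of s] by (simp_all add: mult_assoc)

lemma star_mult_left [simp]:
  "\<lbrakk>s \<in> S; x \<in> S\<rbrakk> \<Longrightarrow> m s (m (star s) (m s x)) = m s x"
  "\<lbrakk>s \<in> S; x \<in> S\<rbrakk> \<Longrightarrow> m (star s) (m s (m (star s) x)) = m (star s) x"
  using star_props[of s] by (metis mult_assoc mult_closed)+

lemma star_star [simp]: "s \<in> S \<Longrightarrow> star (star s) = s"
  by (rule star_unique) (simp_all add: mult_assoc)

lemma star_zero [simp]: "star z = z"
  by (rule star_unique) simp_all

lemma idemsI: "\<lbrakk>e \<in> S; m e e = e\<rbrakk> \<Longrightarrow> e \<in> idems S m"
  by (simp add: idems_def)

lemma idems_in [simp]: "e \<in> idems S m \<Longrightarrow> e \<in> S"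
  and idems_idem [simp]: "e \<in> idems S m \<Longrightarrow> m e e = e"
  by (simp_all add: idems_def)

lemma idems_idem_left [simp]: "\<lbrakk>e \<in> idems S m; x \<in> S\<rbrakk> \<Longrightarrow> m e (m e x) = m e x"
  by (metis idems_in idems_idem mult_assoc)

lemma star_idem [simp]: "e \<in> idems S m \<Longrightarrow> star e = e"
  by (rule star_unique) simp_all

text \<open>Let \<open>?x\<close> be the inverse of \<open>m e f\<close>. Then
  \<open>m f (m ?x e)\<close> is an inverse too, so uniqueness identifies it with \<open>?x\<close>,
  and it is idempotent. An idempotent is its own inverse, hence \<open>m e f\<close> equals
  \<open>?x\<close>.\<close>

lemma mult_idems_idem:
  assumes e: "e \<in> idems S m" and f: "f \<in> idems S m"
  shows "m e f \<in> idems S m"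
proof -
  let ?x = "star (m e f)"
  have S [simp]: "e \<in> S" "f \<in> S" "?x \<in> S"
    using e f by simp_all
  have 1: "m e (m f (m ?x (m e f))) = m e f"
    using star_props(2)[of "m e f"] by (simp add: mult_assoc del: star_mult)
  have 2: "m ?x (m e (m f ?x)) = ?x"
    using star_props(3)[of "m e f"] by (simp add: mult_assoc del: star_mult)
  have "m ?x (m e (m f (m ?x e))) = m (m ?x (m e (m f ?x))) e"
    by (simp add: mult_assoc)
  then have 3: "m ?x (m e (m f (m ?x e))) = m ?x e"
    using 2 by simp
  have "?x = m f (m ?x e)"
  proof (rule star_unique)
    show "m (m (m e f) (m f (m ?x e))) (m e f) = m e f"
      using e f 1 by (simp add: mult_assoc)
    show "m (m (m f (m ?x e)) (m e f)) (m f (m ?x e)) = m f (m ?x e)"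
      using e f 3 by (simp add: mult_assoc)
  qed simp_all
  then have "m ?x ?x = m (m f (m ?x e)) (m f (m ?x e))"
    by (rule arg_cong2) fact
  also have "\<dots> = m f (m ?x e)"
    using e f 3 by (simp add: mult_assoc)
  also have "\<dots> = ?x"
    using \<open>?x = m f (m ?x e)\<close> by (rule sym)
  finally have "?x \<in> idems S m"
    by (intro idemsI) simp_all
  then have "star ?x = ?x"
    by (rule star_idem)
  then have "m e f = ?x"
    by simp
  then show ?thesis
    using \<open>?x \<in> idems S m\<close> by simp
qed

text \<open>The product in the other order is an inverse of \<open>m e f\<close>, while the
  idempotent \<open>m e f\<close> is its own inverse.\<close>

lemma idems_comm:
  assumes e: "e \<in> idems S m" and f: "f \<in> idems S m"
  shows "m e f = m f e"
proof -
  have S [simp]: "e \<in> S" "f \<in> S"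
    using e f by simp_all
  have ef: "m e f \<in> idems S m" "m f e \<in> idems S m"
    using e f by (simp_all add: mult_idems_idem)
  then have "m (m e f) (m e f) = m e f" "m (m f e) (m f e) = m f e"
    by simp_all
  then have "m e (m f (m e f)) = m e f" "m f (m e (m f e)) = m f e"
    by (simp_all add: mult_assoc)
  then have "star (m e f) = m f e"
    using e f by (intro star_unique) (simp_all add: mult_assoc)
  then show ?thesis
    using star_idem[OF ef(1)] by simp
qed

lemma semilattice_idems: "semilattice_zero (idems S m) m z"
proof
  show "z \<in> idems S m"
    by (intro idemsI) simp_all
qed (auto simp: mult_idems_idem mult_assoc intro: idems_comm)

sublocale E: semilattice_zero "idems S m" m z
  by (rule semilattice_idems)

lemma range_idem [simp]: "s \<in> S \<Longrightarrow> m s (star s) \<in> idems S m"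
  and domain_idem [simp]: "s \<in> S \<Longrightarrow> m (star s) s \<in> idems S m"
  by (auto intro!: idemsI simp: mult_assoc)

text \<open>The range idempotent of \<open>t\<close> commutes with the domain idempotent of
  \<open>s\<close>; after this exchange both inverse equations collapse.\<close>

lemma star_mult_distrib:
  assumes "s \<in> S" "t \<in> S"
  shows "star (m s t) = m (star t) (star s)"
proof (rule star_unique)
  have c: "m (m t (star t)) (m (star s) s) = m (m (star s) s) (m t (star t))"
    using assms by (intro idems_comm) auto
  have "m (m (m s t) (m (star t) (star s))) (m s t) = m (m s (m (m t (star t)) (m (star s) s))) t"
    using assms by (simp add: mult_assoc)
  also have "\<dots> = m s t"
    unfolding c using assms by (simp add: mult_assoc)
  finally show "m (m (m s t) (m (star t) (star s))) (m s t) = m s t" .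
  have "m (m (m (star t) (star s)) (m s t)) (m (star t) (star s))
      = m (m (star t) (m (m (star s) s) (m t (star t)))) (star s)"
    using assms by (simp add: mult_assoc)
  also have "\<dots> = m (star t) (star s)"
    unfolding c[symmetric] using assms by (simp add: mult_assoc)
  finally show "m (m (m (star t) (star s)) (m s t)) (m (star t) (star s)) = m (star t) (star s)" .
qed (use assms in auto)

section \<open>Conjugation of idempotents\<close>

lemma domain_absorb:
  assumes s: "s \<in> S" and x: "x \<in> idems S m" and le: "sleq m x (m (star s) s)"
  shows "m (star s) (m s x) = x"
proof -
  \<comment> \<open>Commuting the idempotents turns the order relation, which is absorption from the
    right, into absorption from the left.\<close>
  have "m (m (star s) s) x = m x (m (star s) s)"
    using s x by (intro idems_comm) auto
  then show ?thesis
    using s x le by (simp add: sleq_def mult_assoc)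
qed

lemma conj_idem:
  assumes s: "s \<in> S" and x: "x \<in> idems S m" and le: "sleq m x (m (star s) s)"
  shows "m (m s x) (star s) \<in> idems S m"
proof -
  have "m (m (m s x) (star s)) (m (m s x) (star s)) = m (m s (m x (m (star s) (m s x)))) (star s)"
    using s x by (simp add: mult_assoc)
  also have "\<dots> = m (m s x) (star s)"
    using domain_absorb[OF assms] x by simp
  finally show ?thesis
    using s x by (intro idemsI) simp_all
qed

lemma conj_le_range:
  assumes "s \<in> S" "x \<in> idems S m"
  shows "sleq m (m (m s x) (star s)) (m s (star s))"
  using assms by (simp add: sleq_def mult_assoc)

lemma conj_conj:
  assumes s: "s \<in> S" and x: "x \<in> idems S m" and le: "sleq m x (m (star s) s)"
  shows "m (m (star s) (m (m s x) (star s))) s = x"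
proof -
  have "m (m (star s) (m (m s x) (star s))) s = m (m (star s) (m s x)) (m (star s) s)"
    using s x by (simp add: mult_assoc)
  also have "\<dots> = x"
    using domain_absorb[OF assms] le by (simp add: sleq_def)
  finally show ?thesis .
qed

lemma conj_mono:
  assumes s: "s \<in> S" and x: "x \<in> idems S m" and y: "y \<in> idems S m"
    and le: "sleq m y (m (star s) s)" and xy: "sleq m x y"
  shows "sleq m (m (m s x) (star s)) (m (m s y) (star s))"
proof -
  have "m (m (m s x) (star s)) (m (m s y) (star s)) = m (m s (m x (m (star s) (m s y)))) (star s)"
    using s x y by (simp add: mult_assoc)
  also have "\<dots> = m (m s x) (star s)"
    using domain_absorb[OF s y le] xy by (simp add: sleq_def)
  finally show ?thesis
    by (simp add: sleq_def)
qed

end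

section \<open>Pure gradings and the independence of conjugation from the chosen element\<close>

locale graded_inv_semigroup = inv_semigroup S m z + group G
  for S :: "'a set" and m :: "'a \<Rightarrow> 'a \<Rightarrow> 'a" and z :: 'a
    and G :: "('g, 'b) monoid_scheme" (structure) +
  fixes \<phi> :: "'a \<Rightarrow> 'g"
  assumes grading: "pure_grading S m z G \<phi>"
begin

abbreviation Eg :: "'g \<Rightarrow> 'a set" where "Eg \<equiv> Egr S m z \<phi>"

abbreviation ph :: "'g \<Rightarrow> 'a \<Rightarrow> 'a" where "ph \<equiv> phimap S m z \<phi>"

lemma grade_closed: "\<lbrakk>s \<in> S; s \<noteq> z\<rbrakk> \<Longrightarrow> \<phi> s \<in> carrier G"
  and grade_mult: "\<lbrakk>s \<in> S; t \<in> S; m s t \<noteq> z\<rbrakk> \<Longrightarrow> \<phi> (m s t) = \<phi> s \<otimes> \<phi> t"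
  and grade_one_iff: "\<lbrakk>s \<in> S; s \<noteq> z\<rbrakk> \<Longrightarrow> \<phi> s = \<one> \<longleftrightarrow> s \<in> idems S m"
proof -
  assume s: "s \<in> S" "s \<noteq> z"
  then show "\<phi> s \<in> carrier G"
    using grading by (simp add: pure_grading_def)
  have "{s \<in> S - {z}. \<phi> s = \<one>} = idems S m - {z}"
    using grading by (simp add: pure_grading_def)
  then show "\<phi> s = \<one> \<longleftrightarrow> s \<in> idems S m"
    using s by (auto simp: set_eq_iff)
next
  assume "s \<in> S" "t \<in> S" "m s t \<noteq> z"
  moreover then have "s \<noteq> z" "t \<noteq> z"
    by auto
  ultimately show "\<phi> (m s t) = \<phi> s \<otimes> \<phi> t"
    using grading by (simp add: pure_grading_def)
qed

lemma star_nonzero: "\<lbrakk>s \<in> S; s \<noteq> z\<rbrakk> \<Longrightarrow> star s \<noteq> z"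
  using star_star star_zero by metis

lemma range_nonzero: "\<lbrakk>s \<in> S; s \<noteq> z\<rbrakk> \<Longrightarrow> m s (star s) \<noteq> z"
  using star_props(2)[of s] mult_zero_left by metis

lemma grade_star:
  assumes "s \<in> S" "s \<noteq> z"
  shows "\<phi> (star s) = inv (\<phi> s)"
proof -
  have "\<phi> (m s (star s)) = \<one>"
    using assms grade_one_iff range_nonzero by simp
  then have "\<phi> s \<otimes> \<phi> (star s) = \<one>"
    using grade_mult[of s "star s"] range_nonzero assms by simp
  then show ?thesis
    using assms grade_closed star_nonzero by (metis inv_equality inv_inv star_closed)
qed

text \<open>By purity \<open>s x t\<^sup>*\<close> is an idempotent, so \<open>s x\<close> and \<open>t x\<close> lie below one another.\<close>

lemma same_grade_agree:
  assumes s: "s \<in> S" "s \<noteq> z" and t: "t \<in> S" "t \<noteq> z" and st: "\<phi> s = \<phi> t"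
    and x: "x \<in> idems S m" "x \<noteq> z"
    and le: "sleq m x (m (star s) s)" "sleq m x (m (star t) t)"
  shows "m s x = m t x"
proof -
  define e where "e = m (m s x) (star (m t x))"
  have xS [simp]: "x \<in> S" and [simp]: "m x x = x"
    using x by simp_all
  have ds: "m (star (m s x)) (m s x) = x" and dt: "m (star (m t x)) (m t x) = x"
    using domain_absorb[OF s(1) x(1) le(1)] domain_absorb[OF t(1) x(1) le(2)] s t x
    by (simp_all add: star_mult_distrib mult_assoc)
  have nz: "m s x \<noteq> z" "m t x \<noteq> z"
    using ds dt x s t by (metis mult_closed mult_zero_right star_closed xS)+
  have eb: "m e (m t x) = m s x"
    unfolding e_def using s t x dt by (simp add: mult_assoc)
  have "e \<noteq> z"
    using eb nz t by (metis mult_closed mult_zero_left xS)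
  have "\<phi> (m s x) = \<phi> s" "\<phi> (m t x) = \<phi> t"
    using grade_mult[of s x] grade_mult[of t x] nz s t x grade_one_iff[of x] grade_closed by simp_all
  moreover have "\<phi> e = \<phi> (m s x) \<otimes> \<phi> (star (m t x))"
    unfolding e_def using \<open>e \<noteq> z\<close> s t x unfolding e_def by (intro grade_mult) auto
  ultimately have "\<phi> e = \<one>"
    using st grade_star[of "m t x"] nz t grade_closed by simp
  moreover have "e \<in> S"
    unfolding e_def using s t by simp
  ultimately have e: "e \<in> idems S m"
    using \<open>e \<noteq> z\<close> grade_one_iff by blast
  \<comment> \<open>The idempotent \<open>e\<close> equals its own star, in which \<open>s\<close>
    and \<open>t\<close> are exchanged; so \<open>e\<close> carries \<open>m s x\<close> to
    \<open>m t x\<close>, besides carrying \<open>m t x\<close> to \<open>m s x\<close>.\<close>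
  have "star e = m (m t x) (star (m s x))"
    unfolding e_def using s t by (simp add: star_mult_distrib[of "m s x"])
  then have "m e (m s x) = m t x"
    using e s t x ds by (simp add: mult_assoc)
  moreover have "m e (m s x) = m s x"
    using eb e t by (metis idems_idem_left mult_closed xS)
  ultimately show ?thesis
    by simp
qed

text \<open>The choice hidden in \<open>SOME\<close> is harmless: by
  \<open>same_grade_agree\<close>, all admissible elements have the same product with
  \<open>x\<close>, and the conjugate depends only on that product.\<close>

lemma phimap_eq:
  assumes s: "s \<in> S" "s \<noteq> z" "\<phi> s = g" and x: "x \<in> idems S m" "sleq m x (m (star s) s)"
  shows "ph g x = m (m s x) (star s)"
proof (cases "x = z")
  case True
  then show ?thesis
    using s by (simp add: phimap_def)
next
  case False
  let ?Q = "\<lambda>y. \<exists>s\<in>S - {z}. \<phi> s = g \<and> sleq m x (m (star s) s) \<and> y = m (m s x) (star s)"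
  define y where "y = (SOME y. ?Q y)"
  have "?Q (m (m s x) (star s))"
    using s x by auto
  then have "?Q y"
    unfolding y_def by (rule someI[of ?Q])
  then obtain t where t: "t \<in> S" "t \<noteq> z" "\<phi> t = g" "sleq m x (m (star t) t)"
    and y: "y = m (m t x) (star t)"
    by auto
  have "m t x = m s x"
    using same_grade_agree[of t s x] s t x False by simp
  \<comment> \<open>As \<open>x\<close> is an idempotent, the conjugate of \<open>x\<close> by
    \<open>t\<close> is the range idempotent of \<open>m t x\<close>.\<close>
  moreover have "m (m t x) (star t) = m (m t x) (star (m t x))"
    "m (m s x) (star s) = m (m s x) (star (m s x))"
    using s t x by (simp_all add: star_mult_distrib mult_assoc)
  ultimately have "y = m (m s x) (star s)"
    using y by simp
  moreover have "ph g x = y"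
    unfolding phimap_def y_def using False by simp
  ultimately show ?thesis
    by simp
qed

section \<open>The graded ideals and the isomorphisms between them\<close>

lemma Egr_subset: "Eg g \<subseteq> idems S m"
  using E.zero_closed by (auto simp: Egr_def)

lemma Egr_ideal: "semilattice_ideal (Eg g) (idems S m) m z"
proof
  show "Eg g \<subseteq> idems S m"
    by (rule Egr_subset)
  show "z \<in> Eg g"
    by (simp add: Egr_def)
  fix x y assume x: "x \<in> Eg g" and y: "y \<in> idems S m" "sleq m y x"
  show "y \<in> Eg g"
  proof (cases "x = z")
    case True
    then show ?thesis
      using y by (simp add: sleq_def Egr_def)
  next
    case False
    then obtain s where s: "s \<in> S - {z}" "\<phi> s = g" "sleq m x (m s (star s))" "x \<in> idems S m"
      using x by (auto simp: Egr_def)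
    then have "sleq m y (m s (star s))"
      using y E.sleq_trans[of y x "m s (star s)"] by simp
    then show ?thesis
      using s y by (auto simp: Egr_def)
  qed
qed

text \<open>An element of degree \<open>inv g\<close> whose range lies above \<open>x\<close> has a
  star of degree \<open>g\<close> whose domain lies above \<open>x\<close>. So
  \<open>phimap_eq\<close> applies to every nonzero \<open>x\<close>.\<close>

lemma Egr_cases:
  assumes x: "x \<in> Eg (inv g)" and g: "g \<in> carrier G"
  obtains "x = z" | s where "s \<in> S" "s \<noteq> z" "\<phi> s = g" "sleq m x (m (star s) s)" "x \<in> idems S m"
proof (cases "x = z")
  case False
  then obtain s where s: "s \<in> S" "s \<noteq> z" "\<phi> s = inv g" "sleq m x (m s (star s))" "x \<in> idems S m"
    using x by (auto simp: Egr_def)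
  then show ?thesis
    using that(2)[of "star s"] g grade_star[of s] star_nonzero by simp
qed (use that in blast)

lemma phimap_closed:
  assumes g: "g \<in> carrier G" and x: "x \<in> Eg (inv g)"
  shows "ph g x \<in> Eg g"
  using x g
proof (cases rule: Egr_cases)
  case 1
  then show ?thesis by (simp add: phimap_def Egr_def)
next
  case (2 s)
  then have "ph g x = m (m s x) (star s)"
    by (intro phimap_eq)
  then show ?thesis
    using 2 conj_idem[of s x] conj_le_range[of s x] by (auto simp: Egr_def)
qed

text \<open>If \<open>s\<close> computes \<open>ph g\<close>, then \<open>star s\<close>, of degree
  \<open>inv g\<close>, computes the second map, and the two conjugations cancel.\<close>

lemma phimap_inverse:
  assumes g: "g \<in> carrier G" and x: "x \<in> Eg (inv g)"
  shows "ph (inv g) (ph g x) = x"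
  using x g
proof (cases rule: Egr_cases)
  case 1
  then show ?thesis by (simp add: phimap_def)
next
  case (2 s)
  then have "ph g x = m (m s x) (star s)"
    by (intro phimap_eq)
  moreover have "ph (inv g) (m (m s x) (star s)) = m (m (star s) (m (m s x) (star s))) (star (star s))"
    using 2 grade_star star_nonzero conj_idem[of s x] conj_le_range[of s x] by (intro phimap_eq) auto
  ultimately show ?thesis
    using 2 conj_conj[of s x] by simp
qed

text \<open>One element \<open>s\<close> whose domain lies above \<open>y\<close> computes both
  values, and conjugation by \<open>s\<close> is monotone.\<close>

lemma phimap_mono:
  assumes g: "g \<in> carrier G" and x: "x \<in> Eg (inv g)" and y: "y \<in> Eg (inv g)" and le: "sleq m x y"
  shows "sleq m (ph g x) (ph g y)"
  using y g
proof (cases rule: Egr_cases)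
  case 1
  then have "x = z"
    using x le Egr_subset[of "inv g"] by (auto simp: sleq_def)
  then show ?thesis
    using 1 by (simp add: phimap_def sleq_def)
next
  case (2 s)
  have xE: "x \<in> idems S m"
    using x Egr_subset by blast
  then have "sleq m x (m (star s) s)"
    using 2 le E.sleq_trans[of x y "m (star s) s"] by simp
  then have "ph g x = m (m s x) (star s)" "ph g y = m (m s y) (star s)"
    using phimap_eq[of s g x] phimap_eq[of s g y] 2 xE by simp_all
  then show ?thesis
    using conj_mono[of s x y] 2 xE le by simp
qed

lemma Egr_semilattice: "semilattice_zero (Eg g) m z"
proof -
  interpret semilattice_ideal "Eg g" "idems S m" m z by (rule Egr_ideal)
  show ?thesis by unfold_locales
qed

lemma phimap_iso:
  assumes g: "g \<in> carrier G"
  shows "semilattice_iso (Eg (inv g)) (Eg g) m z (ph g) (ph (inv g))"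
proof -
  interpret A: semilattice_zero "Eg (inv g)" m z by (rule Egr_semilattice)
  interpret B: semilattice_zero "Eg g" m z by (rule Egr_semilattice)
  have g': "inv g \<in> carrier G" "inv (inv g) = g"
    using g by simp_all
  show ?thesis
    by unfold_locales (use g g' phimap_closed[OF g] phimap_closed[OF g'(1)] phimap_inverse[OF g]
        phimap_inverse[OF g'(1)] phimap_mono[OF g] phimap_mono[OF g'(1)] in auto)
qed

end

section \<open>The partial action and locally constant functions\<close>

context graded_inv_semigroup
begin

abbreviation psi :: "'g \<Rightarrow> 'a set set \<Rightarrow> 'a set set" where "psi \<equiv> psiact S m z G \<phi>"

abbreviation ideal :: "'g \<Rightarrow> 'a set set set" where "ideal \<equiv> Iact S m z \<phi>"

abbreviation emb_ideal :: "'g \<Rightarrow> 'a set set \<Rightarrow> 'a set set" where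
  "emb_ideal g \<equiv> emb (Eg g) (idems S m) m"

text \<open>Injectivity of \<open>emb\<close> makes the definite description in
  \<open>psiact\<close> return \<open>U\<close>, so the description can be avoided from here
  on.\<close>

lemma psi_emb:
  assumes U: "U \<in> Tc (Eg (inv g)) m"
  shows "psi g (emb_ideal (inv g) U) = emb_ideal g ((\<lambda>\<xi>. ph g ` \<xi>) ` U)"
proof -
  interpret I: semilattice_ideal "Eg (inv g)" "idems S m" m z by (rule Egr_ideal)
  have "(THE U'. U' \<in> Tc (Eg (inv g)) m \<and> emb_ideal (inv g) U' = emb_ideal (inv g) U) = U"
    using U I.emb_inj by (intro the_equality) (auto dest: inj_onD)
  then show ?thesis
    by (simp add: psiact_def Let_def)
qed

lemma ideal_subset_Tc: "ideal g \<subseteq> Tc (idems S m) m"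
proof -
  interpret I: semilattice_ideal "Eg g" "idems S m" m z by (rule Egr_ideal)
  show ?thesis
    unfolding Iact_def using I.emb_in_Tc by blast
qed

lemma psi_closed:
  assumes g: "g \<in> carrier G" and V: "V \<in> ideal (inv g)"
  shows "psi g V \<in> ideal g"
proof -
  interpret I: semilattice_iso "Eg (inv g)" "Eg g" m z "ph g" "ph (inv g)"
    using g by (rule phimap_iso)
  obtain U where "U \<in> Tc (Eg (inv g)) m" "V = emb_ideal (inv g) U"
    using V unfolding Iact_def by blast
  then show ?thesis
    unfolding Iact_def using I.image_Tc psi_emb by blast
qed

lemma ideal_empty: "{} \<in> ideal g"
proof -
  interpret I: semilattice_ideal "Eg g" "idems S m" m z by (rule Egr_ideal)
  have "emb_ideal g {} = {}"
    by (simp add: emb_def)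
  then show ?thesis
    unfolding Iact_def using I.A.Tc_empty by (metis imageI)
qed

lemma psi_empty: "psi g {} = {}"
proof -
  interpret I: semilattice_ideal "Eg (inv g)" "idems S m" m z by (rule Egr_ideal)
  show ?thesis
    using psi_emb[of "{}" g] by (simp add: emb_def)
qed

text \<open>Since \<open>emb\<close> has trivial kernel, disjointness of \<open>V\<close> and
  \<open>W\<close> passes to their preimages, and taking images under the injective
  \<open>ph g\<close> keeps it. It is the condition under which \<open>lift\<close> has the expected
  level sets.\<close>

lemma psi_disjoint:
  assumes g: "g \<in> carrier G" and V: "V \<in> ideal (inv g)" "W \<in> ideal (inv g)" and dis: "V \<inter> W = {}"
  shows "psi g V \<inter> psi g W = {}"
proof -
  interpret J: semilattice_ideal "Eg (inv g)" "idems S m" m z by (rule Egr_ideal)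
  interpret I: semilattice_iso "Eg (inv g)" "Eg g" m z "ph g" "ph (inv g)"
    using g by (rule phimap_iso)
  obtain U U' where U: "U \<in> Tc (Eg (inv g)) m" "V = emb_ideal (inv g) U"
    and U': "U' \<in> Tc (Eg (inv g)) m" "W = emb_ideal (inv g) U'"
    using V unfolding Iact_def by blast
  have "emb_ideal (inv g) (U \<inter> U') = {}"
    using dis U U' by (simp add: emb_Int)
  then have 0: "U \<inter> U' = {}"
    using J.emb_eq_empty_iff[OF J.A.Tc_Int[OF U(1) U'(1)]] by simp
  have sub: "\<xi> \<subseteq> Eg (inv g)" if "\<xi> \<in> U \<union> U'" for \<xi>
  proof -
    have "U \<union> U' \<subseteq> tight (Eg (inv g)) m"
      using U(1) U'(1) unfolding Tc_def compactin_subtopology by blast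
    then show ?thesis
      using that J.A.tight_subset by blast
  qed
  have "\<xi> \<noteq> \<xi>' \<Longrightarrow> ph g ` \<xi> \<noteq> ph g ` \<xi>'" if "\<xi> \<in> U" "\<xi>' \<in> U'" for \<xi> \<xi>'
    using inj_on_image_eq_iff[OF I.map_inj, of \<xi> \<xi>'] sub that by blast
  then have "(\<lambda>\<xi>. ph g ` \<xi>) ` U \<inter> (\<lambda>\<xi>. ph g ` \<xi>) ` U' = {}"
    using 0 by blast
  then show ?thesis
    unfolding U(2) U'(2) psi_emb[OF U(1)] psi_emb[OF U'(1)] by (simp add: emb_empty flip: emb_Int)
qed

lemma ideal_Un:
  assumes "V \<in> ideal g" "W \<in> ideal g"
  shows "V \<union> W \<in> ideal g"
proof -
  interpret I: semilattice_ideal "Eg g" "idems S m" m z by (rule Egr_ideal)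
  obtain U U' where U: "U \<in> Tc (Eg g) m" "V = emb_ideal g U"
    and U': "U' \<in> Tc (Eg g) m" "W = emb_ideal g U'"
    using assms unfolding Iact_def by blast
  then have "V \<union> W = emb_ideal g (U \<union> U')"
    by (simp add: emb_Un)
  then show ?thesis
    unfolding Iact_def using I.A.Tc_Un[OF U(1) U'(1)] by blast
qed

lemma ideal_Int:
  assumes "V \<in> ideal g" "W \<in> Tc (idems S m) m"
  shows "V \<inter> W \<in> ideal g"
proof -
  interpret I: semilattice_ideal "Eg g" "idems S m" m z by (rule Egr_ideal)
  show ?thesis
    using assms I.emb_Int_image unfolding Iact_def by blast
qed

end

text \<open>The images of different nonzero level sets are disjoint, so at each point at most one
  summand of \<open>lift\<close> survives.\<close>

lemma lift_level:
  assumes h: "finite (range h)"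
    and dis: "\<And>r r'. \<lbrakk>r \<noteq> 0; r' \<noteq> 0; r \<noteq> r'\<rbrakk> \<Longrightarrow> \<psi> {\<eta>. h \<eta> = r} \<inter> \<psi> {\<eta>. h \<eta> = r'} = {}"
    and empty: "\<psi> {} = {}" and r: "r \<noteq> 0"
  shows "{\<xi>. lift \<psi> h \<xi> = r} = \<psi> {\<eta>. h \<eta> = r}"
proof -
  have eq: "lift \<psi> h \<xi> = r" if r: "r \<noteq> 0" and \<xi>: "\<xi> \<in> \<psi> {\<eta>. h \<eta> = r}" for r \<xi>
  proof -
    \<comment> \<open>Because \<open>\<psi>\<close> sends the empty set to itself, \<open>r\<close>
      is attained by \<open>h\<close> and so occurs as an index of the sum.\<close>
    have "{\<eta>. h \<eta> = r} \<noteq> {}"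
      using \<xi> empty by (metis emptyE)
    then have mem: "r \<in> range h - {0}"
      using r by auto
    have "lift \<psi> h \<xi> = (\<Sum>r' \<in> range h - {0}. if r' = r then r' else 0)"
      unfolding lift_def using dis[OF r] \<xi> by (intro sum.cong refl) auto
    also have "\<dots> = r"
      using mem h by (simp add: sum.delta)
    finally show ?thesis .
  qed
  have "\<xi> \<in> \<psi> {\<eta>. h \<eta> = r}" if l: "lift \<psi> h \<xi> = r" for \<xi>
  proof (rule ccontr)
    assume n: "\<xi> \<notin> \<psi> {\<eta>. h \<eta> = r}"
    have "\<xi> \<notin> \<psi> {\<eta>. h \<eta> = r'}" if "r' \<noteq> 0" for r'
      using eq[OF that] l n by blast
    then have "lift \<psi> h \<xi> = 0"
      unfolding lift_def by (intro sum.neutral) auto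
    then show False
      using l r by simp
  qed
  then show ?thesis
    using eq[OF r] by blast
qed

text \<open>By \<open>lift_level\<close>, the nonzero level sets are the images under
  \<open>\<psi>\<close> of those of \<open>h\<close>; apart from zero, only values of
  \<open>h\<close> can therefore occur.\<close>

lemma lift_in_Lc:
  assumes h: "h \<in> Lc X I"
    and dis: "\<And>V W. \<lbrakk>V \<in> I; W \<in> I; V \<inter> W = {}\<rbrakk> \<Longrightarrow> \<psi> V \<inter> \<psi> W = {}"
    and empty: "\<psi> {} = {}" and closed: "\<And>V. V \<in> I \<Longrightarrow> \<psi> V \<in> J" and sub: "\<And>V. V \<in> J \<Longrightarrow> V \<subseteq> X"
  shows "lift \<psi> h \<in> Lc X J"
proof -
  have fin: "finite (range h)" and lev: "\<And>r. r \<noteq> 0 \<Longrightarrow> {\<xi>. h \<xi> = r} \<in> I"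
    using h by (auto simp: Lc_def)
  have L: "{\<xi>. lift \<psi> h \<xi> = r} = \<psi> {\<eta>. h \<eta> = r}" if "r \<noteq> 0" for r
    using fin _ empty that by (rule lift_level) (intro dis lev; auto)
  show ?thesis
    unfolding Lc_def
  proof (intro CollectI conjI allI impI)
    show "{\<xi>. lift \<psi> h \<xi> = r} \<in> J" if "r \<noteq> 0" for r
      unfolding L[OF that] by (intro closed lev that)
    show "lift \<psi> h \<xi> = 0" if "\<xi> \<notin> X" for \<xi>
    proof (rule ccontr)
      assume "lift \<psi> h \<xi> \<noteq> 0"
      then have "\<xi> \<in> \<psi> {\<eta>. h \<eta> = lift \<psi> h \<xi>}" "\<psi> {\<eta>. h \<eta> = lift \<psi> h \<xi>} \<subseteq> X"
        using L[of "lift \<psi> h \<xi>"] sub[OF closed[OF lev]] by blast+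
      then show False
        using that by blast
    qed
    have "range (lift \<psi> h) \<subseteq> insert 0 (range h)"
    proof
      fix r assume "r \<in> range (lift \<psi> h)"
      then obtain \<xi> where \<xi>: "lift \<psi> h \<xi> = r"
        by blast
      show "r \<in> insert 0 (range h)"
      proof (cases "r = 0")
        case False
        then have "\<psi> {\<eta>. h \<eta> = r} \<noteq> {}"
          using L \<xi> by blast
        then have "{\<eta>. h \<eta> = r} \<noteq> {}"
          using empty by metis
        then show ?thesis
          by blast
      qed simp
    qed
    then show "finite (range (lift \<psi> h))"
      using fin by (meson finite.insertI finite_subset)
  qed
qed

text \<open>A level set of the product at a nonzero \<open>r\<close> is a finite union of
  intersections of level sets at pairs with product \<open>r\<close>; both entries of such a pair
  are nonzero.\<close>

lemma mult_in_Lc: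
  assumes h: "h \<in> Lc X I" and k: "k \<in> Lc X J"
    and empty: "{} \<in> I" and Un: "\<And>V W. \<lbrakk>V \<in> I; W \<in> I\<rbrakk> \<Longrightarrow> V \<union> W \<in> I"
    and Int: "\<And>V W. \<lbrakk>V \<in> I; W \<in> J\<rbrakk> \<Longrightarrow> V \<inter> W \<in> I"
  shows "(\<lambda>\<xi>. h \<xi> * k \<xi>) \<in> Lc X I"
proof -
  have fin: "finite (range h)" "finite (range k)"
    and lev: "\<And>r. r \<noteq> 0 \<Longrightarrow> {\<xi>. h \<xi> = r} \<in> I" "\<And>r. r \<noteq> 0 \<Longrightarrow> {\<xi>. k \<xi> = r} \<in> J"
    and 0: "\<And>\<xi>. \<xi> \<notin> X \<Longrightarrow> h \<xi> = 0"
    using h k by (auto simp: Lc_def)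
  have Union: "finite K \<Longrightarrow> K \<subseteq> I \<Longrightarrow> \<Union>K \<in> I" for K
    by (induction K rule: finite_induct) (auto simp: empty Un)
  show ?thesis
    unfolding Lc_def
  proof (intro CollectI conjI allI impI)
    show "h \<xi> * k \<xi> = 0" if "\<xi> \<notin> X" for \<xi>
      using 0[OF that] by simp
    have "range (\<lambda>\<xi>. h \<xi> * k \<xi>) \<subseteq> (\<lambda>(a, b). a * b) ` (range h \<times> range k)"
      by auto
    then show "finite (range (\<lambda>\<xi>. h \<xi> * k \<xi>))"
      using fin by (meson finite_SigmaI finite_imageI finite_subset)
    fix r :: 'b assume r: "r \<noteq> 0"
    let ?T = "{(a, b) \<in> range h \<times> range k. a * b = r}"
    have "{\<xi>. h \<xi> * k \<xi> = r} = \<Union>((\<lambda>(a, b). {\<xi>. h \<xi> = a} \<inter> {\<xi>. k \<xi> = b}) ` ?T)"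
      by auto
    moreover have "\<dots> \<in> I"
    proof (rule Union)
      have "finite ?T"
        using fin by (auto intro: finite_subset[OF _ finite_cartesian_product])
      then show "finite ((\<lambda>(a, b). {\<xi>. h \<xi> = a} \<inter> {\<xi>. k \<xi> = b}) ` ?T)"
        by (rule finite_imageI)
      have "{\<xi>. h \<xi> = a} \<inter> {\<xi>. k \<xi> = b} \<in> I" if "a * b = r" for a b
      proof -
        have "a \<noteq> 0" "b \<noteq> 0"
          using that r by auto
        then show ?thesis
          by (intro Int lev)
      qed
      then show "(\<lambda>(a, b). {\<xi>. h \<xi> = a} \<inter> {\<xi>. k \<xi> = b}) ` ?T \<subseteq> I"
        by auto
    qed
    ultimately show "{\<xi>. h \<xi> * k \<xi> = r} \<in> I"
      by simp
  qed
qed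

section \<open>Pulling functions back along the restriction of tight filters\<close>

definition pull :: "'a set \<Rightarrow> 'a set \<Rightarrow> ('a \<Rightarrow> 'a \<Rightarrow> 'a) \<Rightarrow> ('a set \<Rightarrow> 'r::comm_ring_1) \<Rightarrow> 'a set \<Rightarrow> 'r" where
  "pull P Q m h \<xi> = (if \<xi> \<in> tight Q m \<and> \<xi> \<inter> P \<noteq> {} then h (\<xi> \<inter> P) else 0)"

text \<open>Restriction is only partially defined and \<open>pull\<close> extends by zero, so the
  zero level set also contains the filters that miss \<open>P\<close>; hence the formula is for
  nonzero values.\<close>

lemma pull_level: "r \<noteq> 0 \<Longrightarrow> {\<xi>. pull P Q m h \<xi> = r} = emb P Q m {\<xi>. h \<xi> = r}"
  unfolding pull_def emb_def by auto

lemma pull_zero [simp]: "pull P Q m (\<lambda>_. 0) = (\<lambda>_. 0)"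
  by (simp add: pull_def fun_eq_iff)

lemma pull_in_Lc:
  assumes h: "h \<in> Lc X I" and emb: "\<And>U. U \<in> I \<Longrightarrow> emb P Q m U \<in> J"
  shows "pull P Q m h \<in> Lc (tight Q m) J"
  unfolding Lc_def
proof (intro CollectI conjI allI impI)
  have "range (pull P Q m h) \<subseteq> insert 0 (range h)"
    by (auto simp: pull_def)
  then show "finite (range (pull P Q m h))"
    using h by (auto simp: Lc_def intro: finite_subset)
  show "{\<xi>. pull P Q m h \<xi> = r} \<in> J" if "r \<noteq> 0" for r
    unfolding pull_level[OF that] using h that by (intro emb) (simp add: Lc_def)
qed (simp add: pull_def)

context cover_preserving
begin

text \<open>A function is determined by its nonzero level sets, and \<open>emb\<close> is injective
  on these.\<close>

lemma pull_inj:
  assumes h: "h \<in> Lc X (Tc P m)" and k: "k \<in> Lc X (Tc P m)" and e: "pull P Q m h = pull P Q m k"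
  shows "h = k"
proof -
  have lev: "{\<xi>. h \<xi> = r} = {\<xi>. k \<xi> = r}" if r: "r \<noteq> 0" for r
  proof (rule inj_onD[OF emb_inj])
    show "emb P Q m {\<xi>. h \<xi> = r} = emb P Q m {\<xi>. k \<xi> = r}"
      using e by (simp flip: pull_level[OF r])
  qed (use h k r in \<open>simp_all add: Lc_def\<close>)
  have iff: "h \<xi> = r \<longleftrightarrow> k \<xi> = r" if "r \<noteq> 0" for \<xi> r
    using lev[OF that] by (simp add: set_eq_iff)
  show ?thesis
  proof
    fix \<xi> show "h \<xi> = k \<xi>"
      using iff[of "h \<xi>" \<xi>] iff[of "k \<xi>" \<xi>] by metis
  qed
qed

text \<open>Since \<open>emb\<close> has trivial kernel, no nonzero value is lost. Thus the sums
  defining \<open>lift\<close> before and after pulling back have the same index set.\<close>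

lemma range_pull:
  assumes h: "h \<in> Lc X (Tc P m)"
  shows "range (pull P Q m h) - {0} = range h - {0}"
proof -
  have "r \<in> range (pull P Q m h) \<longleftrightarrow> r \<in> range h" if r: "r \<noteq> 0" for r
  proof -
    have "r \<in> range (pull P Q m h) \<longleftrightarrow> {\<xi>. pull P Q m h \<xi> = r} \<noteq> {}"
      by auto
    also have "\<dots> \<longleftrightarrow> {\<xi>. h \<xi> = r} \<noteq> {}"
      unfolding pull_level[OF r] using h r by (subst emb_eq_empty_iff) (auto simp: Lc_def)
    also have "\<dots> \<longleftrightarrow> r \<in> range h"
      by auto
    finally show ?thesis .
  qed
  then show ?thesis
    by blast
qed

text \<open>With equal index sets by \<open>range_pull\<close>, the sums are compared term by term,
  applying equivariance of \<open>emb\<close> to each nonzero level set of \<open>h\<close>.\<close>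

lemma pull_lift:
  assumes h: "h \<in> Lc X I" and I: "I \<subseteq> Tc P m"
    and equiv: "\<And>U. U \<in> I \<Longrightarrow> emb P Q m (\<psi>1 U) = \<psi>2 (emb P Q m U)"
  shows "pull P Q m (lift \<psi>1 h) = lift \<psi>2 (pull P Q m h)"
proof
  fix \<xi>
  have hT: "h \<in> Lc X (Tc P m)"
    using h I by (auto simp: Lc_def)
  have "lift \<psi>2 (pull P Q m h) \<xi>
      = (\<Sum>r\<in>range h - {0}. if \<xi> \<in> \<psi>2 {\<eta>. pull P Q m h \<eta> = r} then r else 0)"
    unfolding lift_def range_pull[OF hT] ..
  also have "\<dots> = (\<Sum>r\<in>range h - {0}. if \<xi> \<in> emb P Q m (\<psi>1 {\<eta>. h \<eta> = r}) then r else 0)"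
  proof (rule sum.cong[OF refl])
    fix r assume "r \<in> range h - {0}"
    then have r: "r \<noteq> 0"
      by simp
    then have "{\<eta>. h \<eta> = r} \<in> I"
      using h by (simp add: Lc_def)
    then show "(if \<xi> \<in> \<psi>2 {\<eta>. pull P Q m h \<eta> = r} then r else 0)
        = (if \<xi> \<in> emb P Q m (\<psi>1 {\<eta>. h \<eta> = r}) then r else 0)"
      unfolding pull_level[OF r] by (simp add: equiv)
  qed
  \<comment> \<open>If \<open>\<xi>\<close> is not tight or misses \<open>P\<close>, no image under
    \<open>emb\<close> contains it, so every summand is zero, matching the default value of
    \<open>pull\<close>.\<close>
  also have "\<dots> = pull P Q m (lift \<psi>1 h) \<xi>"
    unfolding pull_def lift_def emb_def by (auto intro: sum.neutral)
  finally show "pull P Q m (lift \<psi>1 h) \<xi> = lift \<psi>2 (pull P Q m h) \<xi>"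
    by simp
qed

end

section \<open>Inclusions of graded inverse semigroups\<close>

locale graded_inclusion =
  A: graded_inv_semigroup S1 m z G \<phi> + B: graded_inv_semigroup S2 m z G \<phi>
  for S1 S2 :: "'a set" and m :: "'a \<Rightarrow> 'a \<Rightarrow> 'a" and z :: 'a
    and G :: "('g, 'b) monoid_scheme" (structure) and \<phi> :: "'a \<Rightarrow> 'g" +
  assumes S_subset: "S1 \<subseteq> S2"
    and covers: "preserves_finite_covers (idems S1 m) (idems S2 m) m z"
begin

text \<open>The inverse taken in \<open>S1\<close> solves the defining equations in
  \<open>S2\<close>, where solutions are unique.\<close>

lemma star_eq:
  assumes "s \<in> S1"
  shows "sinv S1 m s = sinv S2 m s"
  using assms S_subset A.star_props[OF assms] by (intro B.star_unique[symmetric]) auto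

lemma idems_subset: "idems S1 m \<subseteq> idems S2 m"
  using S_subset unfolding idems_def by blast

sublocale E: cover_preserving "idems S1 m" "idems S2 m" m z
  by unfold_locales (rule idems_subset covers)+

abbreviation emb_idems :: "'a set set \<Rightarrow> 'a set set" where
  "emb_idems \<equiv> emb (idems S1 m) (idems S2 m) m"

lemma Egr_mono: "A.Eg g \<subseteq> B.Eg g"
proof
  fix x assume x: "x \<in> A.Eg g"
  show "x \<in> B.Eg g"
  proof (cases "x = z")
    case False
    then obtain s where "s \<in> S1 - {z}" "\<phi> s = g" "sleq m x (m s (sinv S1 m s))" "x \<in> idems S1 m"
      using x by (auto simp: Egr_def)
    then show ?thesis
      using S_subset idems_subset star_eq unfolding Egr_def by auto
  qed (simp add: Egr_def)
qed

text \<open>A cover in the graded ideal of \<open>S1\<close> is a cover in all idempotents of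
  \<open>S1\<close>, then in those of \<open>S2\<close> by hypothesis, and finally in the graded
  ideal of \<open>S2\<close>, which contains it.\<close>

lemma Egr_cover_preserving: "cover_preserving (A.Eg g) (B.Eg g) m z"
proof -
  interpret I: semilattice_ideal "A.Eg g" "idems S1 m" m z by (rule A.Egr_ideal)
  interpret J: semilattice_ideal "B.Eg g" "idems S2 m" m z by (rule B.Egr_ideal)
  have "preserves_finite_covers (A.Eg g) (B.Eg g) m z"
    unfolding preserves_finite_covers_def
  proof (intro ballI allI impI)
    fix x C assume x: "x \<in> A.Eg g" and C: "finite_cover (A.Eg g) m z x C"
    have "finite_cover (idems S1 m) m z x C"
      using I.covers x C unfolding preserves_finite_covers_def by blast
    then have "finite_cover (idems S2 m) m z x C"
      using covers x A.Egr_subset unfolding preserves_finite_covers_def by blast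
    moreover have "C \<subseteq> B.Eg g"
      using C Egr_mono by (auto simp: finite_cover_def)
    ultimately show "finite_cover (B.Eg g) m z x C"
      using B.Egr_subset unfolding finite_cover_def by blast
  qed
  then show ?thesis
    by unfold_locales (use Egr_mono in auto)
qed

text \<open>The same \<open>s\<close> in \<open>S1\<close> computes both maps, since its star is the
  same in \<open>S1\<close> and \<open>S2\<close>.\<close>

lemma phimap_ext:
  assumes g: "g \<in> carrier G" and x: "x \<in> A.Eg (inv g)"
  shows "B.ph g x = A.ph g x"
  using x g
proof (cases rule: A.Egr_cases)
  case 1
  then show ?thesis by (simp add: phimap_def)
next
  case (2 s)
  moreover have "s \<in> S2" "x \<in> idems S2 m"
    using 2 S_subset idems_subset by auto
  ultimately show ?thesis
    using A.phimap_eq[of s g x] B.phimap_eq[of s g x] star_eq by simp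
qed

text \<open>By \<open>emb_emb\<close>, both sides equal the direct embedding from
  \<open>A.Eg g\<close> into the idempotents of \<open>S2\<close>.\<close>

lemma emb_ideal_eq: "emb_idems (A.emb_ideal g U) = B.emb_ideal g (emb (A.Eg g) (B.Eg g) m U)"
proof -
  interpret J: semilattice_ideal "B.Eg g" "idems S2 m" m z by (rule B.Egr_ideal)
  show ?thesis
    using E.emb_emb[OF A.Egr_subset] J.emb_emb[OF Egr_mono] by simp
qed

lemma emb_ideal_closed:
  assumes "V \<in> A.ideal g"
  shows "emb_idems V \<in> B.ideal g"
proof -
  interpret C: cover_preserving "A.Eg g" "B.Eg g" m z by (rule Egr_cover_preserving)
  obtain U where "U \<in> Tc (A.Eg g) m" "V = A.emb_ideal g U"
    using assms unfolding Iact_def by blast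
  then show ?thesis
    unfolding Iact_def using emb_ideal_eq C.emb_in_Tc by blast
qed

text \<open>The maps \<open>B.ph g\<close> extend \<open>A.ph g\<close>, so \<open>image_emb\<close>
  gives equivariance on the graded ideals; \<open>emb_ideal_eq\<close> transports it to the full
  semilattices.\<close>

lemma emb_psi:
  assumes g: "g \<in> carrier G" and V: "V \<in> A.ideal (inv g)"
  shows "emb_idems (A.psi g V) = B.psi g (emb_idems V)"
proof -
  interpret C: cover_preserving "A.Eg (inv g)" "B.Eg (inv g)" m z by (rule Egr_cover_preserving)
  obtain U where U: "U \<in> Tc (A.Eg (inv g)) m" "V = A.emb_ideal (inv g) U"
    using V unfolding Iact_def by blast
  have "U \<subseteq> tight (A.Eg (inv g)) m"
    using U(1) by (simp add: Tc_def compactin_subtopology)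
  then have im: "(\<lambda>\<xi>. B.ph g ` \<xi>) ` emb (A.Eg (inv g)) (B.Eg (inv g)) m U
      = emb (A.Eg g) (B.Eg g) m ((\<lambda>\<xi>. A.ph g ` \<xi>) ` U)"
    using A.phimap_iso[OF g] B.phimap_iso[OF g] Egr_mono phimap_ext[OF g] by (intro image_emb)
  have "emb_idems (A.psi g V) = B.emb_ideal g (emb (A.Eg g) (B.Eg g) m ((\<lambda>\<xi>. A.ph g ` \<xi>) ` U))"
    unfolding U(2) A.psi_emb[OF U(1)] emb_ideal_eq ..
  also have "\<dots> = B.psi g (emb_idems V)"
    unfolding U(2) emb_ideal_eq B.psi_emb[OF C.emb_in_Tc[OF U(1)]] im ..
  finally show ?thesis .
qed

lemma pa_morphism_emb:
  "pa_morphism G (Tc (idems S1 m) m) A.ideal A.psi (Tc (idems S2 m) m) B.ideal B.psi emb_idems"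
  unfolding pa_morphism_def gba_hom_def
  by (intro conjI ballI image_subsetI E.emb_in_Tc emb_Un emb_Int emb_Diff emb_ideal_closed emb_psi)

section \<open>The homomorphism of graded algebras\<close>

abbreviation pull_idems :: "('a set \<Rightarrow> 'r::comm_ring_1) \<Rightarrow> 'a set \<Rightarrow> 'r" where
  "pull_idems \<equiv> pull (idems S1 m) (idems S2 m) m"

abbreviation (input) LR_map :: "('g \<Rightarrow> 'a set \<Rightarrow> 'r::comm_ring_1) \<Rightarrow> 'g \<Rightarrow> 'a set \<Rightarrow> 'r" where
  "LR_map a \<equiv> \<lambda>t. pull_idems (a t)"

lemma carrier_Lc:
  assumes "a \<in> LR_carrier S1 m z G \<phi>"
  shows "a t \<in> Lc (tight (idems S1 m) m) (A.ideal t)"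
    and "a t \<in> Lc (tight (idems S1 m) m) (Tc (idems S1 m) m)"
proof -
  have "(\<lambda>_. 0) \<in> Lc (tight (idems S1 m) m) (A.ideal t)"
    by (simp add: Lc_def A.ideal_empty)
  then show "a t \<in> Lc (tight (idems S1 m) m) (A.ideal t)"
    using assms by (cases "t \<in> carrier G") (auto simp: cp_carrier_def)
  then show "a t \<in> Lc (tight (idems S1 m) m) (Tc (idems S1 m) m)"
    using A.ideal_subset_Tc by (auto simp: Lc_def)
qed

text \<open>An element and its image have the same support, so finiteness of the support carries
  over and product sums run over the same pairs of degrees.\<close>

lemma LR_map_eq_zero_iff:
  assumes "a \<in> LR_carrier S1 m z G \<phi>"
  shows "LR_map a t = (\<lambda>_. 0) \<longleftrightarrow> a t = (\<lambda>_. 0)"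
proof
  have "(\<lambda>_. 0) \<in> Lc (tight (idems S1 m) m) (Tc (idems S1 m) m)"
    by (simp add: Lc_def)
  then show "LR_map a t = (\<lambda>_. 0) \<Longrightarrow> a t = (\<lambda>_. 0)"
    using E.pull_inj[of "a t" "tight (idems S1 m) m" "\<lambda>_. 0"] carrier_Lc(2)[OF assms] by simp
qed simp

lemma LR_map_closed:
  assumes a: "a \<in> LR_carrier S1 m z G \<phi>"
  shows "LR_map a \<in> LR_carrier S2 m z G \<phi>"
  unfolding cp_carrier_def
proof (intro CollectI conjI allI impI ballI)
  show "finite {t. LR_map a t \<noteq> (\<lambda>_. 0)}"
    unfolding LR_map_eq_zero_iff[OF a] using a by (simp add: cp_carrier_def)
  show "LR_map a t = (\<lambda>_. 0)" if "t \<notin> carrier G" for t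
    unfolding LR_map_eq_zero_iff[OF a] using a that by (simp add: cp_carrier_def)
  show "LR_map a t \<in> Lc (tight (idems S2 m) m) (B.ideal t)" for t
    using carrier_Lc(1)[OF a] emb_ideal_closed by (rule pull_in_Lc)
qed

lemma LR_map_inj: "inj_on LR_map (LR_carrier S1 m z G \<phi>)"
proof (rule inj_onI, rule ext)
  fix a b :: "'g \<Rightarrow> 'a set \<Rightarrow> 'r::comm_ring_1" and t
  assume "a \<in> LR_carrier S1 m z G \<phi>" "b \<in> LR_carrier S1 m z G \<phi>" "LR_map a = LR_map b"
  then show "a t = b t"
    using E.pull_inj[OF carrier_Lc(2) carrier_Lc(2)] by metis
qed

text \<open>Pulling back commutes with pointwise products and, by \<open>pull_lift\<close>, with
  both lifts; the work is to see that each function being lifted has its level sets in the correct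
  ideal.\<close>

lemma pull_coefficient:
  assumes a: "a \<in> LR_carrier S1 m z G \<phi>" and b: "b \<in> LR_carrier S1 m z G \<phi>" and s: "s \<in> carrier G"
  shows "pull_idems (lift (A.psi s) (\<lambda>\<eta>. lift (A.psi (inv s)) (a s) \<eta> * b t \<eta>))
       = lift (B.psi s) (\<lambda>\<eta>. lift (B.psi (inv s)) (LR_map a s) \<eta> * LR_map b t \<eta>)"
proof -
  let ?X = "tight (idems S1 m) m"
  have s': "inv s \<in> carrier G" "inv (inv s) = s"
    using s by simp_all
  \<comment> \<open>The domain of \<open>A.psi (inv s)\<close> is the ideal at
    \<open>inv (inv s)\<close>, so the degree is rewritten into that form.\<close>
  have as: "a s \<in> Lc ?X (A.ideal (inv (inv s)))"
    using carrier_Lc(1)[OF a, of s] s' by simp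
  have sub: "V \<subseteq> ?X" if "V \<in> A.ideal (inv s)" for V
    using A.ideal_subset_Tc that by (auto simp: Tc_def compactin_subtopology)
  have l: "lift (A.psi (inv s)) (a s) \<in> Lc ?X (A.ideal (inv s))"
    using as A.psi_disjoint[OF s'(1)] A.psi_empty A.psi_closed[OF s'(1)] sub by (rule lift_in_Lc)
  \<comment> \<open>Intersecting with the level sets of \<open>b t\<close> stays in the ideal at
    \<open>inv s\<close>, where \<open>A.psi s\<close> is defined.\<close>
  have "(\<lambda>\<eta>. lift (A.psi (inv s)) (a s) \<eta> * b t \<eta>) \<in> Lc ?X (A.ideal (inv s))"
    using l carrier_Lc(2)[OF b] A.ideal_empty A.ideal_Un A.ideal_Int by (rule mult_in_Lc)
  then have "pull_idems (lift (A.psi s) (\<lambda>\<eta>. lift (A.psi (inv s)) (a s) \<eta> * b t \<eta>))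
      = lift (B.psi s) (pull_idems (\<lambda>\<eta>. lift (A.psi (inv s)) (a s) \<eta> * b t \<eta>))"
    using A.ideal_subset_Tc emb_psi[OF s] by (rule E.pull_lift)
  also have "pull_idems (\<lambda>\<eta>. lift (A.psi (inv s)) (a s) \<eta> * b t \<eta>)
      = (\<lambda>\<eta>. pull_idems (lift (A.psi (inv s)) (a s)) \<eta> * LR_map b t \<eta>)"
    by (auto simp: pull_def)
  also have "pull_idems (lift (A.psi (inv s)) (a s)) = lift (B.psi (inv s)) (LR_map a s)"
    using as A.ideal_subset_Tc emb_psi[OF s'(1)] by (rule E.pull_lift)
  finally show ?thesis .
qed

text \<open>Equal supports give equal index sets for the two product sums; the summands agree by
  \<open>pull_coefficient\<close>.\<close>

lemma LR_map_mult:
  assumes a: "a \<in> LR_carrier S1 m z G \<phi>" and b: "b \<in> LR_carrier S1 m z G \<phi>"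
  shows "LR_map (LR_mult S1 m z G \<phi> a b) = LR_mult S2 m z G \<phi> (LR_map a) (LR_map b)"
proof (intro ext)
  fix u \<xi>
  let ?K = "{(s, t). a s \<noteq> (\<lambda>_. 0) \<and> b t \<noteq> (\<lambda>_. 0) \<and> s \<otimes> t = u}"
  have "LR_mult S2 m z G \<phi> (LR_map a) (LR_map b) u \<xi>
      = (\<Sum>(s, t)\<in>?K. lift (B.psi s) (\<lambda>\<eta>. lift (B.psi (inv s)) (LR_map a s) \<eta> * LR_map b t \<eta>) \<xi>)"
    unfolding cp_mult_def LR_map_eq_zero_iff[OF a] LR_map_eq_zero_iff[OF b] ..
  also have "\<dots> = (\<Sum>(s, t)\<in>?K. pull_idems (lift (A.psi s) (\<lambda>\<eta>. lift (A.psi (inv s)) (a s) \<eta> * b t \<eta>)) \<xi>)"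
  proof (rule sum.cong[OF refl], clarify)
    fix s t assume "a s \<noteq> (\<lambda>_. 0)"
    then have "s \<in> carrier G"
      using a by (auto simp: cp_carrier_def)
    then show "lift (B.psi s) (\<lambda>\<eta>. lift (B.psi (inv s)) (LR_map a s) \<eta> * LR_map b t \<eta>) \<xi>
        = pull_idems (lift (A.psi s) (\<lambda>\<eta>. lift (A.psi (inv s)) (a s) \<eta> * b t \<eta>)) \<xi>"
      using pull_coefficient[OF a b] by simp
  qed
  also have "\<dots> = LR_map (LR_mult S1 m z G \<phi> a b) u \<xi>"
    by (auto simp: pull_def cp_mult_def split_def intro!: sum.neutral)
  finally show "LR_map (LR_mult S1 m z G \<phi> a b) u \<xi> = LR_mult S2 m z G \<phi> (LR_map a) (LR_map b) u \<xi>"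
    by simp
qed

lemma LR_map_xdelta:
  assumes "x \<in> idems S1 m"
  shows "LR_map (xdelta (idems S1 m) m x g) = xdelta (idems S2 m) m x g"
proof (intro ext)
  fix t \<xi>
  show "LR_map (xdelta (idems S1 m) m x g) t \<xi> = xdelta (idems S2 m) m x g t \<xi>"
    using E.emb_Vset[OF assms, of "[]"] unfolding pull_def xdelta_def emb_def by auto
qed

end

section \<open>Passage to the inverse subsemigroup and assembly of the result\<close>

lemma inverse_subsemigroup_inverse_semigroup:
  assumes S2: "inverse_semigroup_zero S2 m z" and S1: "inverse_subsemigroup S1 S2 m z"
  shows "inverse_semigroup_zero S1 m z"
proof -
  interpret inv_semigroup S2 m z
    by (rule inv_semigroup.intro[OF S2])
  have sub: "S1 \<subseteq> S2"
    using S1 by (simp add: inverse_subsemigroup_def)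
  have "\<exists>!t. t \<in> S1 \<and> m (m s t) s = s \<and> m (m t s) t = t" if s: "s \<in> S1" for s
  proof (rule ex1I[of _ "star s"])
    show "star s \<in> S1 \<and> m (m s (star s)) s = s \<and> m (m (star s) s) (star s) = star s"
      using S1 s sub star_props[of s] by (auto simp: inverse_subsemigroup_def)
    show "t = star s" if "t \<in> S1 \<and> m (m s t) s = s \<and> m (m t s) t = t" for t
      using star_unique[of s t] that s sub by auto
  qed
  then show ?thesis
    using S1 sub unfolding inverse_semigroup_zero_def inverse_subsemigroup_def
    by (auto simp: mult_assoc subset_iff)
qed

lemma pure_grading_subset:
  assumes "pure_grading S2 m z G \<phi>" "S1 \<subseteq> S2"
  shows "pure_grading S1 m z G \<phi>"
proof -
  have "{s \<in> S2 - {z}. \<phi> s = \<one>\<^bsub>G\<^esub>} = idems S2 m - {z}"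
    using assms(1) by (simp add: pure_grading_def)
  then have "{s \<in> S1 - {z}. \<phi> s = \<one>\<^bsub>G\<^esub>} = idems S1 m - {z}"
    using assms(2) by (auto simp: idems_def set_eq_iff)
  then show ?thesis
    using assms unfolding pure_grading_def by (auto simp: subset_iff)
qed

theorem mainTheorem18:
  fixes S1 S2 :: "'a set" and m :: "'a \<Rightarrow> 'a \<Rightarrow> 'a" and z :: 'a
    and G :: "('g, 'b) monoid_scheme" and \<phi> :: "'a \<Rightarrow> 'g"
  assumes "group G"
    and "inverse_semigroup_zero S2 m z"
    and "pure_grading S2 m z G \<phi>"
    and "inverse_subsemigroup S1 S2 m z"
    and "preserves_finite_covers (idems S1 m) (idems S2 m) m z"
  shows "pa_morphism G
           (Tc (idems S1 m) m) (Iact S1 m z \<phi>) (psiact S1 m z G \<phi>)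
           (Tc (idems S2 m) m) (Iact S2 m z \<phi>) (psiact S2 m z G \<phi>)
           (emb (idems S1 m) (idems S2 m) m)
       \<and> inj_on (emb (idems S1 m) (idems S2 m) m) (Tc (idems S1 m) m)
       \<and> (\<exists>F :: ('g \<Rightarrow> 'a set \<Rightarrow> 'r::comm_ring_1) \<Rightarrow> ('g \<Rightarrow> 'a set \<Rightarrow> 'r).
            (\<forall>a \<in> LR_carrier S1 m z G \<phi>. F a \<in> LR_carrier S2 m z G \<phi>)
          \<and> inj_on F (LR_carrier S1 m z G \<phi>)
          \<and> (\<forall>a \<in> LR_carrier S1 m z G \<phi>. \<forall>b \<in> LR_carrier S1 m z G \<phi>.
                F (cp_add a b) = cp_add (F a) (F b)
              \<and> F (LR_mult S1 m z G \<phi> a b) = LR_mult S2 m z G \<phi> (F a) (F b))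
          \<and> (\<forall>c. \<forall>a \<in> LR_carrier S1 m z G \<phi>. F (cp_smult c a) = cp_smult c (F a))
          \<and> (\<forall>g \<in> carrier G. \<forall>a \<in> LR_carrier S1 m z G \<phi>.
                (\<forall>t. t \<noteq> g \<longrightarrow> a t = (\<lambda>_. 0)) \<longrightarrow> (\<forall>t. t \<noteq> g \<longrightarrow> F a t = (\<lambda>_. 0)))
          \<and> (\<forall>g \<in> carrier G. \<forall>x \<in> Egr S1 m z \<phi> g.
                F (xdelta (idems S1 m) m x g) = xdelta (idems S2 m) m x g))"
proof -
  interpret group G by (rule assms(1))
  have sub: "S1 \<subseteq> S2"
    using assms(4) by (simp add: inverse_subsemigroup_def)
  interpret A: graded_inv_semigroup S1 m z G \<phi>
    using inverse_subsemigroup_inverse_semigroup[OF assms(2,4)] pure_grading_subset[OF assms(3) sub]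
    by unfold_locales
  interpret B: graded_inv_semigroup S2 m z G \<phi>
    using assms(2,3) by unfold_locales
  interpret graded_inclusion S1 S2 m z G \<phi>
    using sub assms(5) by unfold_locales
  show ?thesis
  proof (intro conjI exI[of _ LR_map] ballI allI impI)
    \<comment> \<open>\<open>LR_map\<close> treats each coefficient separately and sends zero to
      zero, so it preserves degrees.\<close>
    show "LR_map a t = (\<lambda>_. 0)" if "\<forall>t. t \<noteq> g \<longrightarrow> a t = (\<lambda>_. 0)" "t \<noteq> g" for a t g
      using that by simp
    show "LR_map (cp_add a b) = cp_add (LR_map a) (LR_map b)" "LR_map (cp_smult c a) = cp_smult c (LR_map a)" for a b c
      by (auto simp: fun_eq_iff pull_def cp_add_def cp_smult_def)
    show "LR_map (xdelta (idems S1 m) m x g) = xdelta (idems S2 m) m x g" if "x \<in> A.Eg g" for x g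
      using that A.Egr_subset by (intro LR_map_xdelta) blast
  qed (rule pa_morphism_emb E.emb_inj LR_map_inj; assumption | rule LR_map_closed LR_map_mult; assumption)+
qed

end
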